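(* Let $L\subset\mathbb{R}^n$ be a lattice and let $u_0\in L^\infty(\mathbb{R}^n)$ be $L$-periodic, i.e. $u_0(x+e)=u_0(x)$ for a.e. $x\in\mathbb{R}^n$, for all $e\in L$. Then the largest entropy solution $u_+$ and the smallest entropy solution $u_-$ of the problem $u_t+\operatorname{div}_x\varphi(u)=0$, $u(0,x)=u_0(x)$ are space-periodic (that is, $u_\pm(t,x+e)=u_\pm(t,x)$ for a.e. $(t,x)\in\Pi$, for all $e\in L$) and coincide: $u_+=u_-$ a.e. in $\Pi$.
   Context: Let $n\in\mathbb{N}$, $\mathbb{R}_+=(0,+\infty)$, $\Pi=\mathbb{R}_+\times\mathbb{R}^n$, $\bar\Pi=[0,+\infty)\times\mathbb{R}^n$. $C_0^1(\bar\Pi)$ is the space of $C^1$ functions with compact support in $\bar\Pi$ (not necessarily vanishing at $t=0$). Convention: $\operatorname{sign}0=0$. A lattice in $\mathbb{R}^n$ means a full-rank lattice (the image of $\mathbb{Z}^n$ under an invertible linear map). Flux. $\varphi:\mathbb{R}\to\mathbb{R}^n$ is jump continuous: at each $u\in\mathbb{R}$ the one-sided limits $\varphi(u\pm)$ exist. Its multi-valued extension is $\bar\varphi(u)=[\varphi(u-),\varphi(u)]\cup[\varphi(u),\varphi(u+)]$ (a union of two segments in $\mathbb{R}^n$). Parametrization. Fix a continuous parametrization of the graph of $\bar\varphi$: continuous functions $b:\mathbb{R}\to\mathbb{R}$ and $g:\mathbb{R}\to\mathbb{R}^n$ with $b$ non-strictly increasing and coercive ($b(v)\to\pm\infty$ as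 $v\to\pm\infty$), $g(v)\in\bar\varphi(b(v))$ for all $v$, and $\{(b(v),g(v)):v\in\mathbb{R}\}=\{(u,y):u\in\mathbb{R},\,y\in\bar\varphi(u)\}$ (such a parametrization always exists). Measure valued functions. $\mathrm{MV}(\Pi)$ is the set of bounded measure valued functions on $\Pi$: weakly measurable maps $(t,x)\mapsto\nu_{t,x}$ into compactly supported Borel probability measures on $\mathbb{R}$ (i.e. $(t,x)\mapsto\int p\,d\nu_{t,x}$ is Lebesgue measurable for every $p\in C(\mathbb{R})$), such that for some $R>0$, $\operatorname{supp}\nu_{t,x}\subset[-R,R]$ for a.e. $(t,x)$. Measure valued entropy solution. $\nu\in\mathrm{MV}(\Pi)$ is a measure valued e.s. of $b(v)_t+\operatorname{div}_xg(v)=0$, $b(v)(0,x)=u_0(x)$, if for all $k\in\mathbb{R}$ and all $f\in C_0^1(\bar\Pi)$, $f\ge0$, $$\int_\Pi\Big[\int|b(v)-b(k)|d\nu_{t,x}(v)\,f_t+\int\operatorname{sign}(v-k)(g(v)-g(k))d\nu_{t,x}(v)\cdot\nabla_xf\Big]dtdx+\int_{\mathbb{R}^n}|u_0(x)-b(k)|f(0,x)dx\ge0.$$ Entropy solution. $u\in L^\infty(\Pi)$ is an entropy solution (e.s.) of $u_t+\operatorname{div}_x\varphi(u)=0$, $u(0,x)=u_0(x)$, if there is a measure valued e.s. $\nu$ of $b(v)_t+\operatorname{div}_xg(v)=0$, $b(v)(0,x)=u_0(x)$, such that the push-forward $b^*\nu_{t,x}$ equals the Dirac mass at $u(t,x)$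 for a.e. $(t,x)\in\Pi$. The largest (smallest) e.s. of a Cauchy problem is the e.s. $u_+$ ($u_-$) such that $u\le u_+$ ($u\ge u_-$) a.e. in $\Pi$ for every e.s. $u$ of the same problem (both exist for every initial function in $L^\infty(\mathbb{R}^n)$). *)

theory Defs
  imports "HOL-Probability.Probability"
begin

text \<open>
  Space is \<open>real ^ 'n\<close>, so the dimension \<open>n = CARD('n) \<ge> 1\<close> is arbitrary, and a point
  \<open>(t, x)\<close> of space-time lives in \<open>real \<times> (real ^ 'n)\<close>.
\<close>

definition open_half_space :: "(real \<times> (real ^ 'n)) set" where
  "open_half_space = {0<..} \<times> UNIV"

definition closed_half_space :: "(real \<times> (real ^ 'n)) set" where
  "closed_half_space = {0..} \<times> UNIV"

definition L_infty :: "'a measure \<Rightarrow> ('a \<Rightarrow> real) set" where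
  "L_infty M = {f \<in> borel_measurable M. \<exists>C. AE x in M. \<bar>f x\<bar> \<le> C}"

definition is_lattice :: "(real ^ 'n) set \<Rightarrow> bool" where
  "is_lattice L \<longleftrightarrow>
     (\<exists>A :: real ^ 'n ^ 'n. invertible A \<and> L = (\<lambda>z. A *v z) ` {z. \<forall>i. z $ i \<in> \<int>})"


subsection \<open>Flux and parametrization of its graph\<close>

definition jump_continuous :: "(real \<Rightarrow> real ^ 'n) \<Rightarrow> bool" where
  "jump_continuous \<phi> \<longleftrightarrow>
     (\<forall>u. (\<exists>l. (\<phi> \<longlongrightarrow> l) (at_left u)) \<and> (\<exists>r. (\<phi> \<longlongrightarrow> r) (at_right u)))"

definition flux_ext :: "(real \<Rightarrow> real ^ 'n) \<Rightarrow> real \<Rightarrow> (real ^ 'n) set" where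
  "flux_ext \<phi> u = closed_segment (Lim (at_left u) \<phi>) (\<phi> u)
                \<union> closed_segment (\<phi> u) (Lim (at_right u) \<phi>)"

definition graph_parametrization ::
  "(real \<Rightarrow> real ^ 'n) \<Rightarrow> (real \<Rightarrow> real) \<Rightarrow> (real \<Rightarrow> real ^ 'n) \<Rightarrow> bool" where
  "graph_parametrization \<phi> b g \<longleftrightarrow>
     continuous_on UNIV b \<and> continuous_on UNIV g \<and>
     mono b \<and> filterlim b at_top at_top \<and> filterlim b at_bot at_bot \<and>
     (\<forall>v. g v \<in> flux_ext \<phi> (b v)) \<and>
     range (\<lambda>v. (b v, g v)) = {(u, y). y \<in> flux_ext \<phi> u}"


subsection \<open>Test functions\<close>

text \<open>
  Derivatives are taken within the closed half-space, hence are one-sided in \<open>t\<close> at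
  \<open>t = 0\<close>; they are unique there, so that the Frechet derivative is well defined. Only the
  values on the closed half-space matter for a test function.
\<close>

definition time_deriv :: "(real \<times> (real ^ 'n) \<Rightarrow> real) \<Rightarrow> real \<times> (real ^ 'n) \<Rightarrow> real" where
  "time_deriv f z = frechet_derivative f (at z within closed_half_space) (1, 0)"

definition space_grad :: "(real \<times> (real ^ 'n) \<Rightarrow> real) \<Rightarrow> real \<times> (real ^ 'n) \<Rightarrow> real ^ 'n" where
  "space_grad f z =
     (\<chi> i. frechet_derivative f (at z within closed_half_space) (0, axis i 1))"

definition test_functions :: "(real \<times> (real ^ 'n) \<Rightarrow> real) set" where
  "test_functions =
     {f. f differentiable_on closed_half_space \<and>
         continuous_on closed_half_space (time_deriv f) \<and>
         continuous_on closed_half_space (space_grad f) \<and>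
         compact (closure (support_on closed_half_space f))}"


subsection \<open>Measure valued functions and entropy solutions\<close>

definition measure_support :: "'a::topological_space measure \<Rightarrow> 'a set" where
  "measure_support M = {x. \<forall>U. open U \<and> x \<in> U \<longrightarrow> emeasure M U > 0}"

definition measure_valued_functions :: "(real \<times> (real ^ 'n) \<Rightarrow> real measure) set" where
  "measure_valued_functions =
     {\<nu>. (\<forall>z\<in>open_half_space.
            prob_space (\<nu> z) \<and> sets (\<nu> z) = sets borel \<and> compact (measure_support (\<nu> z))) \<and>
         (\<forall>p :: real \<Rightarrow> real. continuous_on UNIV p \<longrightarrow>
            (\<lambda>z. LINT v|\<nu> z. p v) \<in> borel_measurable (lebesgue_on open_half_space)) \<and>
         (\<exists>R>0. AE z in lebesgue_on open_half_space. measure_support (\<nu> z) \<subseteq> {-R..R})}"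

definition mv_entropy_solution ::
  "(real \<Rightarrow> real) \<Rightarrow> (real \<Rightarrow> real ^ 'n) \<Rightarrow> (real ^ 'n \<Rightarrow> real) \<Rightarrow>
   (real \<times> (real ^ 'n) \<Rightarrow> real measure) \<Rightarrow> bool" where
  "mv_entropy_solution b g u0 \<nu> \<longleftrightarrow>
     \<nu> \<in> measure_valued_functions \<and>
     (\<forall>k. \<forall>f\<in>test_functions. (\<forall>z\<in>closed_half_space. f z \<ge> 0) \<longrightarrow>
        (LINT z|lebesgue_on open_half_space.
            (LINT v|\<nu> z. \<bar>b v - b k\<bar>) * time_deriv f z
          + (LINT v|\<nu> z. sgn (v - k) *\<^sub>R (g v - g k)) \<bullet> space_grad f z)
        + (LINT x|lebesgue. \<bar>u0 x - b k\<bar> * f (0, x)) \<ge> 0)"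

text \<open>
  Entropy solutions of \<open>u\<^sub>t + div \<phi>(u) = 0\<close>, \<open>u(0, \<cdot>) = u0\<close>; the flux \<open>\<phi>\<close> enters only
  through a parametrization \<open>(b, g)\<close> of the graph of its multi-valued extension.
\<close>

definition entropy_solution ::
  "(real \<Rightarrow> real) \<Rightarrow> (real \<Rightarrow> real ^ 'n) \<Rightarrow> (real ^ 'n \<Rightarrow> real) \<Rightarrow>
   (real \<times> (real ^ 'n) \<Rightarrow> real) \<Rightarrow> bool" where
  "entropy_solution b g u0 u \<longleftrightarrow>
     u \<in> L_infty (lebesgue_on open_half_space) \<and>
     (\<exists>\<nu>. mv_entropy_solution b g u0 \<nu> \<and>
        (AE z in lebesgue_on open_half_space. distr (\<nu> z) borel b = return borel (u z)))"

definition largest_entropy_solution ::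
  "(real \<Rightarrow> real) \<Rightarrow> (real \<Rightarrow> real ^ 'n) \<Rightarrow> (real ^ 'n \<Rightarrow> real) \<Rightarrow>
   (real \<times> (real ^ 'n) \<Rightarrow> real) \<Rightarrow> bool" where
  "largest_entropy_solution b g u0 u \<longleftrightarrow>
     entropy_solution b g u0 u \<and>
     (\<forall>w. entropy_solution b g u0 w \<longrightarrow> (AE z in lebesgue_on open_half_space. w z \<le> u z))"

definition smallest_entropy_solution ::
  "(real \<Rightarrow> real) \<Rightarrow> (real \<Rightarrow> real ^ 'n) \<Rightarrow> (real ^ 'n \<Rightarrow> real) \<Rightarrow>
   (real \<times> (real ^ 'n) \<Rightarrow> real) \<Rightarrow> bool" where
  "smallest_entropy_solution b g u0 u \<longleftrightarrow>
     entropy_solution b g u0 u \<and>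
     (\<forall>w. entropy_solution b g u0 w \<longrightarrow> (AE z in lebesgue_on open_half_space. w z \<ge> u z))"

end

(*
  Uniqueness of the largest solution makes it invariant under lattice translations, and likewise
  for the smallest one. Testing the entropy inequality for u+ with k near -infinity and the one
  for u- with k near +infinity turns both into (linear) conservation inequalities with the same
  initial data; adding them, the initial terms cancel and for a cutoff f in [0, T) x B(0, N)
    integral (u+ - u-) (-f_t) <= C integral |grad f| = O(N^(n-1)).
  As u+ - u- is nonnegative and periodic, the left-hand side is at least a constant times N^n
  unless u+ = u-.
*)
theory Submission
  imports Defs
begin

subsection \<open>Translations in space\<close>

text \<open>At a jump of the flux \<open>b\<close> is constant on an interval on which
  \<open>g\<close> varies, so the averaged flux of a measure valued solution is not a function of u.
  The difference of the two fluxes is therefore not controlled by u+ - u-, and no Lipschitz bound or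
  finite speed of propagation is at hand. What remains is boundedness: \<open>g\<close> is
  continuous and almost all the measures live in one interval. The resulting constant depends on k
  and on the solution but not on the cutoff, so k has to be fixed before N grows.

  Once b(k) lies beyond all values of u and u0, the modulus |u - b(k)| has a constant sign and the
  inequality becomes affine in u. The terms carrying b(k) cancel because the integral of f_t is
  minus the integral of f(0, x).

  The lower bound on the mass is found by counting disjoint translates of one small cylinder along a
  sparse part of the lattice, so that neither a fundamental domain nor its volume has to be handled.
  The cutoff is built from squared positive parts: this is just smooth enough, and every derivative
  and integral is explicit.\<close>

abbreviation half_space_measure :: "(real \<times> (real ^ 'n)) measure" where
  "half_space_measure \<equiv> lebesgue_on open_half_space"

text \<open>Written as addition of one fixed vector, so that facts about translations of a Euclidean
  space apply directly to space-time.\<close>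

definition space_shift :: "real ^ 'n \<Rightarrow> real \<times> (real ^ 'n) \<Rightarrow> real \<times> (real ^ 'n)" where
  "space_shift e z = (0, e) + z"

lemma space_shift_Pair [simp]: "space_shift e (t, x) = (t, x + e)"
  by (simp add: space_shift_def add.commute)

lemma space_shift_shift [simp]:
  "space_shift e (space_shift (-e) z) = z" "space_shift (-e) (space_shift e z) = z"
  by (cases z; simp)+

lemma Pair_in_half_space [simp]:
  "(t, x) \<in> open_half_space \<longleftrightarrow> 0 < t" "(t, x) \<in> closed_half_space \<longleftrightarrow> 0 \<le> t"
  by (auto simp: open_half_space_def closed_half_space_def)

lemma space_shift_in_half_space [simp]:
  "space_shift e z \<in> open_half_space \<longleftrightarrow> z \<in> open_half_space"
  "space_shift e z \<in> closed_half_space \<longleftrightarrow> z \<in> closed_half_space"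
  by (cases z; simp)+

lemma open_half_space_open: "open (open_half_space :: (real \<times> (real ^ 'n)) set)"
  unfolding open_half_space_def by (intro open_Times) auto

lemma open_half_space_sets [simp, measurable]:
  "(open_half_space :: (real \<times> (real ^ 'n)) set) \<in> sets borel"
  "(open_half_space :: (real \<times> (real ^ 'n)) set) \<in> sets lebesgue"
  by (simp_all add: open_half_space_open)

lemma open_half_space_imp_closed: "z \<in> open_half_space \<Longrightarrow> z \<in> closed_half_space"
  by (cases z) simp

text \<open>The affine change of variables with all scaling factors equal to 1. The completed
  measure is used because solutions and initial data are only Lebesgue measurable.\<close>

lemma distr_lebesgue_translation:
  fixes a :: "'a::euclidean_space"
  shows "(+) a \<in> lebesgue \<rightarrow>\<^sub>M lebesgue" "distr lebesgue lebesgue ((+) a) = lebesgue"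
proof -
  have T: "(\<lambda>x. a + (\<Sum>j\<in>Basis. (1 * (x \<bullet> j)) *\<^sub>R j)) = (+) a"
    by (simp add: euclidean_representation fun_eq_iff)
  show "(+) a \<in> lebesgue \<rightarrow>\<^sub>M lebesgue"
    using lebesgue_affine_measurable[of "\<lambda>_. 1" a] unfolding T by simp
  show "distr lebesgue lebesgue ((+) a) = lebesgue"
    using lebesgue_affine_euclidean[of "\<lambda>_. 1" a] unfolding T by (simp add: density_1)
qed

text \<open>The shift leaves t alone, so preimages of subsets of the half-space stay inside it and
  invariance reduces to that of Lebesgue measure on the whole space.\<close>

lemma distr_space_shift:
  "space_shift e \<in> half_space_measure \<rightarrow>\<^sub>M half_space_measure" (is ?m)
  "distr half_space_measure half_space_measure (space_shift e) = half_space_measure" (is ?d)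
proof -
  have m: "space_shift e \<in> lebesgue \<rightarrow>\<^sub>M lebesgue"
    using distr_lebesgue_translation(1)[of "(0, e)"] by (simp add: space_shift_def[abs_def])
  show ?m
    by (rule measurable_restrict_space3[OF m]) auto
  note this [measurable]
  have d: "distr lebesgue lebesgue (space_shift e) = lebesgue"
    using distr_lebesgue_translation(2)[of "(0, e)"] by (simp add: space_shift_def[abs_def])
  show ?d
  proof (rule measure_eqI)
    fix X assume "X \<in> sets (distr half_space_measure half_space_measure (space_shift e))"
    then have X: "X \<in> sets half_space_measure" by simp
    then have XH: "X \<subseteq> open_half_space" "X \<in> sets lebesgue"
      by (auto simp: sets_restrict_space_iff)
    then have sub: "space_shift e -` X \<subseteq> open_half_space"
      using space_shift_in_half_space(1) by blast
    have "emeasure (distr half_space_measure half_space_measure (space_shift e)) X =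
        emeasure half_space_measure (space_shift e -` X \<inter> open_half_space)"
      using X by (subst emeasure_distr) auto
    also have "space_shift e -` X \<inter> open_half_space = space_shift e -` X"
      using sub by blast
    also have "emeasure half_space_measure (space_shift e -` X) = emeasure lebesgue (space_shift e -` X)"
      using sub by (subst emeasure_restrict_space) simp_all
    also have "\<dots> = emeasure (distr lebesgue lebesgue (space_shift e)) X"
      using XH by (subst emeasure_distr[OF m]) auto
    also have "\<dots> = emeasure half_space_measure X"
      unfolding d using XH by (subst emeasure_restrict_space) auto
    finally show "emeasure (distr half_space_measure half_space_measure (space_shift e)) X =
      emeasure half_space_measure X" .
  qed simp
qed

lemma AE_space_shift:
  assumes "AE z in half_space_measure. P z"
  shows "AE z in half_space_measure. P (space_shift e z)"
proof -
  have "AE z in distr half_space_measure half_space_measure (space_shift e). P z"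
    unfolding distr_space_shift(2) by (rule assms)
  from AE_distrD[OF distr_space_shift(1) this] show ?thesis .
qed

text \<open>No measurability is assumed: the shift is invertible, so \<open>f\<close> and its
  translate are measurable together, and otherwise both integrals have the default value 0. It can
  thus be applied to entropy integrands without inspecting them.\<close>

lemma integral_space_shift:
  fixes f :: "real \<times> (real ^ 'n) \<Rightarrow> real"
  shows "(LINT z|half_space_measure. f (space_shift e z)) = (LINT z|half_space_measure. f z)"
proof (cases "f \<in> borel_measurable half_space_measure")
  case True
  from integral_distr[OF distr_space_shift(1) True, of e] show ?thesis
    by (simp add: distr_space_shift(2))
next
  case False
  have "(\<lambda>z. f (space_shift e z)) \<notin> borel_measurable half_space_measure"
  proof
    assume "(\<lambda>z. f (space_shift e z)) \<in> borel_measurable half_space_measure"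
    from measurable_compose[OF distr_space_shift(1)[of "-e"] this] False show False by simp
  qed
  with False have "\<not> integrable half_space_measure f"
     "\<not> integrable half_space_measure (\<lambda>z. f (space_shift e z))" by auto
  then show ?thesis by (simp add: not_integrable_integral_eq)
qed

lemma integral_lebesgue_translation:
  fixes f :: "'a::euclidean_space \<Rightarrow> real"
  assumes "f \<in> borel_measurable lebesgue"
  shows "(LINT x|lebesgue. f (a + x)) = (LINT x|lebesgue. f x)"
  using integral_distr[OF distr_lebesgue_translation(1)[of a] assms]
  by (simp add: distr_lebesgue_translation(2))

section \<open>Test functions and entropy solutions under translation\<close>

text \<open>The chain rule for the shift, whose derivative is the identity and which maps the closed
  half-space onto itself; the converse is the same rule for the shift by \<open>-e\<close>.\<close>

lemma has_derivative_space_shift_iff: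
  "((\<lambda>z. f (space_shift e z)) has_derivative D) (at z within closed_half_space) \<longleftrightarrow>
   (f has_derivative D) (at (space_shift e z) within closed_half_space)"
proof -
  have shift: "(space_shift e has_derivative (\<lambda>h. h)) (at z within S)" for e :: "real ^ 'n" and z S
    unfolding space_shift_def[abs_def] by (auto intro!: derivative_eq_intros)
  have im: "space_shift e ` closed_half_space = closed_half_space" for e :: "real ^ 'n"
    by (metis (no_types, lifting) antisym image_iff space_shift_in_half_space(2) space_shift_shift(1) subsetI)
  have chain: "((\<lambda>z. f (space_shift e z)) has_derivative D) (at z within closed_half_space)"
    if "(f has_derivative D) (at (space_shift e z) within closed_half_space)" for e f z D
    using diff_chain_within[OF shift[of e z closed_half_space], of f D] that
    by (simp add: im o_def)
  show ?thesis
    using chain[of f D e z] chain[of "\<lambda>z. f (space_shift e z)" D "-e" "space_shift e z"] by auto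
qed

text \<open>\<open>frechet_derivative\<close> is a choice among the derivatives. By the equivalence
  above both sides choose from the same predicate, so they agree even where no derivative
  exists.\<close>

lemma frechet_derivative_space_shift:
  "frechet_derivative (\<lambda>z. f (space_shift e z)) (at z within closed_half_space) =
   frechet_derivative f (at (space_shift e z) within closed_half_space)"
  unfolding frechet_derivative_def has_derivative_space_shift_iff ..

lemma time_deriv_space_shift:
  "time_deriv (\<lambda>z. f (space_shift e z)) z = time_deriv f (space_shift e z)"
  by (simp add: time_deriv_def frechet_derivative_space_shift)

lemma space_grad_space_shift:
  "space_grad (\<lambda>z. f (space_shift e z)) z = space_grad f (space_shift e z)"
  by (simp add: space_grad_def frechet_derivative_space_shift)

lemma continuous_on_space_shift: "continuous_on S (space_shift e)"
  unfolding space_shift_def[abs_def] by (intro continuous_intros)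

lemma test_functions_space_shift:
  assumes f: "f \<in> test_functions"
  shows "(\<lambda>z. f (space_shift e z)) \<in> test_functions"
proof -
  have sub: "space_shift e ` closed_half_space \<subseteq> closed_half_space" by auto
  have "(\<lambda>z. f (space_shift e z)) differentiable_on closed_half_space"
    using f unfolding test_functions_def differentiable_on_def differentiable_def
      has_derivative_space_shift_iff by auto
  moreover have "continuous_on closed_half_space (time_deriv (\<lambda>z. f (space_shift e z)))"
    "continuous_on closed_half_space (space_grad (\<lambda>z. f (space_shift e z)))"
    using f continuous_on_compose2[OF _ continuous_on_space_shift sub]
    unfolding time_deriv_space_shift[abs_def] space_grad_space_shift[abs_def] test_functions_def
    by auto
  moreover have "compact (closure (support_on closed_half_space (\<lambda>z. f (space_shift e z))))"
  proof -
    have "support_on closed_half_space (\<lambda>z. f (space_shift e z)) =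
       space_shift (-e) ` support_on closed_half_space f"
    proof (intro equalityI subsetI)
      fix z assume "z \<in> support_on closed_half_space (\<lambda>z. f (space_shift e z))"
      then have "space_shift e z \<in> support_on closed_half_space f"
        by (simp add: support_on_def)
      then show "z \<in> space_shift (-e) ` support_on closed_half_space f"
        by (metis image_eqI space_shift_shift(2))
    next
      fix z assume "z \<in> space_shift (-e) ` support_on closed_half_space f"
      then obtain y where "z = space_shift (-e) y" "y \<in> support_on closed_half_space f" by blast
      then show "z \<in> support_on closed_half_space (\<lambda>z. f (space_shift e z))"
        by (simp add: support_on_def)
    qed
    moreover have "bounded (support_on closed_half_space f)"
      using f by (simp add: test_functions_def)
    ultimately show ?thesis
      by (simp add: compact_closure space_shift_def[abs_def] bounded_translation)
  qed
  ultimately show ?thesis by (simp add: test_functions_def)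
qed

lemma measure_valued_functions_space_shift:
  fixes \<nu> :: "real \<times> (real ^ 'n) \<Rightarrow> real measure"
  assumes \<nu>: "\<nu> \<in> measure_valued_functions"
  shows "(\<lambda>z. \<nu> (space_shift e z)) \<in> measure_valued_functions"
proof -
  from \<nu> obtain R where "R > 0"
    and R: "AE z in half_space_measure. measure_support (\<nu> z) \<subseteq> {-R..R}"
    unfolding measure_valued_functions_def by blast
  have "AE z in half_space_measure. measure_support (\<nu> (space_shift e z)) \<subseteq> {-R..R}"
    by (rule AE_space_shift[OF R])
  moreover have "(\<lambda>z. LINT v|\<nu> (space_shift e z). p v) \<in> borel_measurable half_space_measure"
    if "continuous_on UNIV p" for p :: "real \<Rightarrow> real"
    using \<nu> that measurable_compose[OF distr_space_shift(1)]
    unfolding measure_valued_functions_def by blast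
  ultimately show ?thesis
    using \<nu> \<open>R > 0\<close> unfolding measure_valued_functions_def
    by (simp add: space_shift_in_half_space(1)) blast
qed

lemma test_function_initial_continuous:
  assumes "f \<in> test_functions"
  shows "continuous_on UNIV (\<lambda>x. f (0, x))"
proof -
  have "continuous_on closed_half_space f"
    using assms by (simp add: test_functions_def differentiable_imp_continuous_on)
  then show ?thesis
    by (rule continuous_on_compose2) (auto intro!: continuous_intros)
qed

text \<open>The equation has no explicit dependence on x, so testing the translate against
  \<open>f\<close> amounts to testing the original against \<open>f\<close> moved by
  \<open>-e\<close>. Periodicity of \<open>u0\<close> restores the initial term.\<close>

lemma mv_entropy_solution_space_shift:
  fixes \<nu> :: "real \<times> (real ^ 'n) \<Rightarrow> real measure"
  assumes sol: "mv_entropy_solution b g u0 \<nu>"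
    and u0 [measurable]: "u0 \<in> borel_measurable lebesgue"
    and per: "AE x in lebesgue. u0 (x + e) = u0 x"
  shows "mv_entropy_solution b g u0 (\<lambda>z. \<nu> (space_shift e z))"
  unfolding mv_entropy_solution_def
proof (intro conjI allI ballI impI)
  show "(\<lambda>z. \<nu> (space_shift e z)) \<in> measure_valued_functions"
    using sol by (simp add: mv_entropy_solution_def measure_valued_functions_space_shift)
next
  fix k and f :: "real \<times> (real ^ 'n) \<Rightarrow> real"
  assume f: "f \<in> test_functions" and pos: "\<forall>z\<in>closed_half_space. 0 \<le> f z"
  let ?f = "\<lambda>z. f (space_shift (-e) z)"
  let ?F = "\<lambda>z. (LINT v|\<nu> z. \<bar>b v - b k\<bar>) * time_deriv ?f z
          + (LINT v|\<nu> z. sgn (v - k) *\<^sub>R (g v - g k)) \<bullet> space_grad ?f z"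
  have "\<forall>z\<in>closed_half_space. 0 \<le> ?f z"
    using pos space_shift_in_half_space(2) by blast
  then have "0 \<le> (LINT z|half_space_measure. ?F z) + (LINT x|lebesgue. \<bar>u0 x - b k\<bar> * ?f (0, x))"
    by (rule sol[unfolded mv_entropy_solution_def, THEN conjunct2, THEN spec, THEN bspec, THEN mp,
          OF test_functions_space_shift[OF f]])
  also have "(LINT z|half_space_measure. ?F z) = (LINT z|half_space_measure. ?F (space_shift e z))"
    by (rule integral_space_shift[symmetric])
  also have "(LINT x|lebesgue. \<bar>u0 x - b k\<bar> * ?f (0, x)) =
      (LINT x|lebesgue. \<bar>u0 (e + x) - b k\<bar> * ?f (0, e + x))"
  proof (rule integral_lebesgue_translation[symmetric])
    have "(\<lambda>x. ?f (0, x)) \<in> borel_measurable borel"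
      by (rule borel_measurable_continuous_onI
          [OF test_function_initial_continuous[OF test_functions_space_shift[OF f]]])
    then have [measurable]: "(\<lambda>x. ?f (0, x)) \<in> borel_measurable lebesgue"
      by (simp add: measurable_completion)
    show "(\<lambda>x. \<bar>u0 x - b k\<bar> * ?f (0, x)) \<in> borel_measurable lebesgue"
      by measurable
  qed
  also have "\<dots> = (LINT x|lebesgue. \<bar>u0 x - b k\<bar> * f (0, x))"
  proof (rule integral_cong_AE)
    have "(\<lambda>x. f (0, x)) \<in> borel_measurable borel"
      by (rule borel_measurable_continuous_onI[OF test_function_initial_continuous[OF f]])
    then have [measurable]: "(\<lambda>x. f (0, x)) \<in> borel_measurable lebesgue"
      by (simp add: measurable_completion)
    have [measurable]: "(\<lambda>x. u0 (e + x)) \<in> borel_measurable lebesgue"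
      by (rule measurable_compose[OF distr_lebesgue_translation(1) u0])
    show "(\<lambda>x. \<bar>u0 x - b k\<bar> * f (0, x)) \<in> borel_measurable lebesgue"
      by measurable
    show "(\<lambda>x. \<bar>u0 (e + x) - b k\<bar> * ?f (0, e + x)) \<in> borel_measurable lebesgue"
      by (simp; measurable)
    show "AE x in lebesgue. \<bar>u0 (e + x) - b k\<bar> * ?f (0, e + x) = \<bar>u0 x - b k\<bar> * f (0, x)"
      using per by eventually_elim (simp add: add.commute)
  qed
  finally show "0 \<le> (LINT z|half_space_measure.
            (LINT v|\<nu> (space_shift e z). \<bar>b v - b k\<bar>) * time_deriv f z
          + (LINT v|\<nu> (space_shift e z). sgn (v - k) *\<^sub>R (g v - g k)) \<bullet> space_grad f z)
        + (LINT x|lebesgue. \<bar>u0 x - b k\<bar> * f (0, x))"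
    by (simp add: time_deriv_space_shift space_grad_space_shift)
qed

lemma L_infty_space_shift:
  assumes "u \<in> L_infty half_space_measure"
  shows "(\<lambda>z. u (space_shift e z)) \<in> L_infty half_space_measure"
  using assms measurable_compose[OF distr_space_shift(1)[of e], of u borel] AE_space_shift[of "\<lambda>z. \<bar>u z\<bar> \<le> _" e]
  unfolding L_infty_def by blast

lemma entropy_solution_space_shift:
  assumes "entropy_solution b g u0 u"
    and "u0 \<in> borel_measurable lebesgue" "AE x in lebesgue. u0 (x + e) = u0 x"
  shows "entropy_solution b g u0 (\<lambda>z. u (space_shift e z))"
proof -
  from assms(1) obtain \<nu> where u: "u \<in> L_infty half_space_measure"
    and \<nu>: "mv_entropy_solution b g u0 \<nu>"
    and D: "AE z in half_space_measure. distr (\<nu> z) borel b = return borel (u z)"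
    unfolding entropy_solution_def by blast
  show ?thesis
    unfolding entropy_solution_def
    using L_infty_space_shift[OF u] mv_entropy_solution_space_shift[OF \<nu> assms(2,3)] AE_space_shift[OF D]
    by blast
qed

section \<open>Periodicity of the extremal solutions\<close>

lemma lattice_uminus:
  fixes L :: "(real ^ 'n) set"
  assumes "is_lattice L" "e \<in> L"
  shows "-e \<in> L"
proof -
  from assms(1) obtain A :: "real ^ 'n ^ 'n" where L: "L = (\<lambda>z. A *v z) ` {z. \<forall>i. z $ i \<in> \<int>}"
    unfolding is_lattice_def by blast
  with assms(2) obtain z where z: "e = A *v z" "\<forall>i. z $ i \<in> \<int>" by blast
  have "A *v (-z) = -e"
    unfolding z(1) by (rule linear_neg[OF matrix_vector_mul_linear])
  moreover have "\<forall>i. (-z) $ i \<in> \<int>" using z(2) by simp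
  ultimately show ?thesis unfolding L by (intro image_eqI[of _ _ "-z"]) simp_all
qed

text \<open>Extremality compares a solution with its translates in one direction only. The
  inequality for \<open>-e\<close>, itself translated by \<open>e\<close>, is the opposite
  inequality.\<close>

lemma AE_invariant_of_AE_le:
  fixes u :: "real \<times> (real ^ 'n) \<Rightarrow> real"
  assumes le: "\<And>e. e \<in> L \<Longrightarrow> AE z in half_space_measure. u (space_shift e z) \<le> u z"
    and L: "e \<in> L" "-e \<in> L"
  shows "AE z in half_space_measure. u (space_shift e z) = u z"
proof -
  have "AE z in half_space_measure. u (space_shift (-e) (space_shift e z)) \<le> u (space_shift e z)"
    by (rule AE_space_shift[OF le[OF L(2)]])
  with le[OF L(1)] show ?thesis
    by eventually_elim simp
qed

lemma largest_entropy_solution_periodic: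
  assumes "largest_entropy_solution b g u0 u" "is_lattice L" "u0 \<in> L_infty lebesgue"
    "\<forall>e\<in>L. AE x in lebesgue. u0 (x + e) = u0 x" "e \<in> L"
  shows "AE z in half_space_measure. u (space_shift e z) = u z"
proof (rule AE_invariant_of_AE_le[OF _ \<open>e \<in> L\<close> lattice_uminus[OF assms(2,5)]])
  fix e assume "e \<in> L"
  then show "AE z in half_space_measure. u (space_shift e z) \<le> u z"
    using assms entropy_solution_space_shift[of b g u0 u e]
    unfolding largest_entropy_solution_def L_infty_def by blast
qed

lemma smallest_entropy_solution_periodic:
  assumes "smallest_entropy_solution b g u0 u" "is_lattice L" "u0 \<in> L_infty lebesgue"
    "\<forall>e\<in>L. AE x in lebesgue. u0 (x + e) = u0 x" "e \<in> L"
  shows "AE z in half_space_measure. u (space_shift e z) = u z"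
proof -
  \<comment> \<open>Negation turns minimality into the direction required by
    \<open>AE_invariant_of_AE_le\<close>.\<close>
  have "AE z in half_space_measure. - u (space_shift e z) = - u z"
  proof (rule AE_invariant_of_AE_le[OF _ \<open>e \<in> L\<close> lattice_uminus[OF assms(2,5)]])
    fix e assume "e \<in> L"
    then have "AE z in half_space_measure. u z \<le> u (space_shift e z)"
      using assms entropy_solution_space_shift[of b g u0 u e]
      unfolding smallest_entropy_solution_def L_infty_def by blast
    then show "AE z in half_space_measure. - u (space_shift e z) \<le> - u z"
      by eventually_elim simp
  qed
  then show ?thesis by eventually_elim simp
qed

subsection \<open>Kruzhkov inequalities\<close>

text \<open>Each point outside the support has a null neighbourhood taken from a countable basis, so
  the complement of the support is covered by countably many null sets.\<close>

lemma AE_measure_support: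
  fixes M :: "'a::second_countable_topology measure"
  assumes sets: "sets M = sets borel"
  shows "AE x in M. x \<in> measure_support M"
proof -
  obtain \<B> :: "'a set set" where \<B>: "countable \<B>" "topological_basis \<B>"
    using ex_countable_basis by blast
  let ?N = "\<Union>{V \<in> \<B>. emeasure M V = 0}"
  have "?N \<in> null_sets M"
  proof (rule null_sets_UN'[where N = "\<lambda>V. V", unfolded image_ident])
    show "countable {V \<in> \<B>. emeasure M V = 0}" using \<B>(1) by simp
    fix V assume "V \<in> {V \<in> \<B>. emeasure M V = 0}"
    then show "V \<in> null_sets M"
      using topological_basis_open[OF \<B>(2)] by (auto simp: null_sets_def sets)
  qed
  moreover have "x \<in> ?N" if "x \<notin> measure_support M" for x
  proof -
    from that obtain U where U: "open U" "x \<in> U" "emeasure M U = 0"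
      by (auto simp: measure_support_def not_gr_zero)
    then obtain V where V: "V \<in> \<B>" "x \<in> V" "V \<subseteq> U"
      using topological_basisE[OF \<B>(2)] by blast
    moreover have "emeasure M V = 0"
      using emeasure_mono[OF V(3), of M] U by (simp add: sets)
    ultimately show ?thesis by blast
  qed
  ultimately show ?thesis
    by (intro AE_I'[of ?N]) auto
qed

text \<open>A continuous function is bounded on the compact support, which carries all the mass.
  This holds at every point of the half-space rather than almost everywhere, as the pointwise
  identity in \<open>mv_measurable\<close> requires.\<close>

lemma mv_integrable:
  fixes p :: "real \<Rightarrow> 'b::euclidean_space"
  assumes \<nu>: "\<nu> \<in> measure_valued_functions" and z: "z \<in> open_half_space"
    and p: "continuous_on UNIV p"
  shows "integrable (\<nu> z) p"
proof -
  from \<nu> z have ps: "prob_space (\<nu> z)" and s: "sets (\<nu> z) = sets borel"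
    and c: "compact (measure_support (\<nu> z))"
    by (auto simp: measure_valued_functions_def)
  interpret prob_space "\<nu> z" by (rule ps)
  have "bounded (p ` measure_support (\<nu> z))"
    by (intro compact_imp_bounded compact_continuous_image c continuous_on_subset[OF p]) auto
  then obtain B where B: "\<And>v. v \<in> measure_support (\<nu> z) \<Longrightarrow> norm (p v) \<le> B"
    by (auto simp: bounded_iff)
  have "p \<in> borel_measurable (\<nu> z)"
    using borel_measurable_continuous_onI[OF p] s measurable_cong_sets[OF s refl] by blast
  then show ?thesis
    using AE_measure_support[OF s] B by (intro integrable_const_bound[of _ B]) auto
qed

text \<open>Weak measurability is given for real integrands; vector integrands such as the flux are
  treated coordinate by coordinate.\<close>

lemma mv_measurable:
  fixes p :: "real \<Rightarrow> 'b::euclidean_space" and \<nu> :: "real \<times> (real ^ 'n) \<Rightarrow> real measure"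
  assumes \<nu>: "\<nu> \<in> measure_valued_functions" and p: "continuous_on UNIV p"
  shows "(\<lambda>z. LINT v|\<nu> z. p v) \<in> borel_measurable half_space_measure"
proof (subst borel_measurable_euclidean_space, intro ballI)
  fix i :: 'b assume "i \<in> Basis"
  have "(\<lambda>z. LINT v|\<nu> z. p v \<bullet> i) \<in> borel_measurable half_space_measure"
    using \<nu> continuous_on_inner[OF p continuous_on_const, of i]
    by (simp add: measure_valued_functions_def)
  moreover have "(LINT v|\<nu> z. p v) \<bullet> i = (LINT v|\<nu> z. p v \<bullet> i)"
    if "z \<in> space half_space_measure" for z
    using mv_integrable[OF \<nu> _ p, of z] that by (simp add: integral_inner_left)
  ultimately show "(\<lambda>z. (LINT v|\<nu> z. p v) \<bullet> i) \<in> borel_measurable half_space_measure"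
    by (subst measurable_cong) auto
qed

lemma mv_AE_bounded:
  fixes \<nu> :: "real \<times> (real ^ 'n) \<Rightarrow> real measure"
  assumes \<nu>: "\<nu> \<in> measure_valued_functions"
  obtains R where "AE z in half_space_measure. AE v in \<nu> z. v \<in> {-R..R}"
proof -
  from \<nu> obtain R where R: "AE z in half_space_measure. measure_support (\<nu> z) \<subseteq> {-R..R}"
    unfolding measure_valued_functions_def by blast
  have "AE z in half_space_measure. AE v in \<nu> z. v \<in> {-R..R}"
    using R AE_space
  proof eventually_elim
    case (elim z)
    then have "sets (\<nu> z) = sets borel"
      using \<nu> by (auto simp: measure_valued_functions_def)
    from AE_measure_support[OF this] show ?case
      by eventually_elim (use elim(1) in auto)
  qed
  then show thesis by (rule that)
qed

text \<open>Unlike the left-hand side, the right-hand side is visibly continuous in \<open>v\<close>.\<close>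

lemma sgn_scaleR_diff:
  fixes g :: "real \<Rightarrow> 'b::real_vector"
  shows "sgn (v - k) *\<^sub>R (g v - g k) = g (max v k) - g (min v k)"
  by (cases v k rule: linorder_cases) (auto simp: max_def min_def)

text \<open>Nonnegative test functions together with the integrability that allows the entropy
  integral to be split into its time, flux and initial parts.\<close>

definition admissible_test :: "(real \<times> (real ^ 'n) \<Rightarrow> real) \<Rightarrow> bool" where
  "admissible_test f \<longleftrightarrow> f \<in> test_functions \<and> (\<forall>z\<in>closed_half_space. 0 \<le> f z) \<and>
     integrable half_space_measure (time_deriv f) \<and> integrable half_space_measure (space_grad f) \<and>
     integrable lebesgue (\<lambda>x. f (0, x))"

text \<open>By \<open>sgn_scaleR_diff\<close> the Kruzhkov flux is continuous in v, hence bounded on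
  the common interval that carries almost every measure.\<close>

lemma mv_flux_bound:
  fixes \<nu> :: "real \<times> (real ^ 'n) \<Rightarrow> real measure" and g :: "real \<Rightarrow> real ^ 'n"
  assumes \<nu>: "\<nu> \<in> measure_valued_functions" and g: "continuous_on UNIV g"
  obtains D where "D \<ge> 0"
    "AE z in half_space_measure. norm (LINT v|\<nu> z. sgn (v - k) *\<^sub>R (g v - g k)) \<le> D"
proof -
  obtain R where R: "AE z in half_space_measure. AE v in \<nu> z. v \<in> {-R..R}"
    using mv_AE_bounded[OF \<nu>] .
  define q where "q = (\<lambda>v. sgn (v - k) *\<^sub>R (g v - g k))"
  have q: "continuous_on UNIV q"
    unfolding q_def sgn_scaleR_diff
    by (intro continuous_intros continuous_on_compose2[OF g]) auto
  have "bounded (q ` {-R..R})"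
    by (intro compact_imp_bounded compact_continuous_image continuous_on_subset[OF q]) auto
  then obtain D where D: "D > 0" "\<And>v. v \<in> {-R..R} \<Longrightarrow> norm (q v) \<le> D"
    unfolding bounded_pos by auto
  have "AE z in half_space_measure. norm (LINT v|\<nu> z. q v) \<le> D"
    using R AE_space
  proof eventually_elim
    case (elim z)
    then have ps: "prob_space (\<nu> z)" and z: "z \<in> open_half_space"
      using \<nu> by (auto simp: measure_valued_functions_def)
    interpret prob_space "\<nu> z" by (rule ps)
    have "norm (LINT v|\<nu> z. q v) \<le> (LINT v|\<nu> z. norm (q v))" by simp
    also have "\<dots> \<le> (LINT v|\<nu> z. D)"
      using elim(1) mv_integrable[OF \<nu> z q] D(2) by (intro integral_mono_AE) auto
    finally show ?case by (simp add: prob_space)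
  qed
  with D(1) show thesis unfolding q_def by (intro that[of D]) auto
qed

text \<open>Since the push-forward under \<open>b\<close> is a Dirac mass, the measure disappears
  from the time term; in the flux term it is replaced by a crude bound. \<open>D\<close> is obtained
  before \<open>f\<close>, so one constant serves cutoffs of every size.\<close>

lemma entropy_solution_inequality:
  fixes g :: "real \<Rightarrow> real ^ 'n"
  assumes sol: "entropy_solution b g u0 u"
    and b: "continuous_on UNIV b" and g: "continuous_on UNIV g"
  obtains D where "D \<ge> 0" "\<And>f. admissible_test f \<Longrightarrow>
    0 \<le> (LINT z|half_space_measure. \<bar>u z - b k\<bar> * time_deriv f z)
       + D * (LINT z|half_space_measure. norm (space_grad f z))
       + (LINT x|lebesgue. \<bar>u0 x - b k\<bar> * f (0, x))"
proof -
  from sol obtain \<nu> where u: "u \<in> L_infty half_space_measure"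
    and mv: "mv_entropy_solution b g u0 \<nu>"
    and D: "AE z in half_space_measure. distr (\<nu> z) borel b = return borel (u z)"
    unfolding entropy_solution_def by blast
  from mv have \<nu>: "\<nu> \<in> measure_valued_functions" by (simp add: mv_entropy_solution_def)
  define U where "U z = (LINT v|\<nu> z. \<bar>b v - b k\<bar>)" for z
  define V where "V z = (LINT v|\<nu> z. sgn (v - k) *\<^sub>R (g v - g k))" for z
  obtain D where D0: "D \<ge> 0" and V_le: "AE z in half_space_measure. norm (V z) \<le> D"
    using mv_flux_bound[OF \<nu> g, of k] unfolding V_def by blast
  have U_eq: "AE z in half_space_measure. U z = \<bar>u z - b k\<bar>"
    using D AE_space
  proof eventually_elim
    case (elim z)
    then have s: "sets (\<nu> z) = sets borel"
      using \<nu> by (auto simp: measure_valued_functions_def)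
    have bm: "b \<in> \<nu> z \<rightarrow>\<^sub>M borel"
      using borel_measurable_continuous_onI[OF b] measurable_cong_sets[OF s refl] by blast
    have "U z = (LINT w|distr (\<nu> z) borel b. \<bar>w - b k\<bar>)"
      unfolding U_def by (rule integral_distr[OF bm, symmetric]) simp
    also have "\<dots> = \<bar>u z - b k\<bar>"
      unfolding elim(1) by (rule integral_return) auto
    finally show ?case .
  qed
  have U_m: "U \<in> borel_measurable half_space_measure"
    unfolding U_def by (intro mv_measurable[OF \<nu>] continuous_intros b)
  have V_m: "V \<in> borel_measurable half_space_measure"
    unfolding V_def sgn_scaleR_diff
    by (intro mv_measurable[OF \<nu>] continuous_intros continuous_on_compose2[OF g]) auto
  obtain C where C: "AE z in half_space_measure. \<bar>u z\<bar> \<le> C"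
    and um: "u \<in> borel_measurable half_space_measure"
    using u by (auto simp: L_infty_def)
  note [measurable] = U_m V_m um
  show thesis
  proof (rule that[OF D0])
    fix f :: "real \<times> (real ^ 'n) \<Rightarrow> real" assume f: "admissible_test f"
    then have t: "integrable half_space_measure (time_deriv f)"
      and s: "integrable half_space_measure (space_grad f)"
      by (auto simp: admissible_test_def)
    note [measurable] = borel_measurable_integrable[OF t] borel_measurable_integrable[OF s]
    \<comment> \<open>The Bochner integral of a non-integrable function is 0, so the integral of the
      sum may be split only after both summands are known to be integrable.\<close>
    have i1: "integrable half_space_measure (\<lambda>z. U z * time_deriv f z)"
    proof (rule Bochner_Integration.integrable_bound[OF integrable_mult_right[OF t]])
      show "AE z in half_space_measure.
          norm (U z * time_deriv f z) \<le> norm ((C + \<bar>b k\<bar>) * time_deriv f z)"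
        using U_eq C by eventually_elim (auto simp: abs_mult intro!: mult_right_mono)
    qed simp
    have i2: "integrable half_space_measure (\<lambda>z. V z \<bullet> space_grad f z)"
    proof (rule Bochner_Integration.integrable_bound[OF integrable_mult_right[OF integrable_norm[OF s]]])
      show "AE z in half_space_measure.
          norm (V z \<bullet> space_grad f z) \<le> norm (D * norm (space_grad f z))"
        using V_le
      proof eventually_elim
        case (elim z)
        have "norm (V z \<bullet> space_grad f z) \<le> norm (V z) * norm (space_grad f z)"
          using Cauchy_Schwarz_ineq2 by simp
        also have "\<dots> \<le> D * norm (space_grad f z)"
          using elim by (intro mult_right_mono) auto
        finally show ?case using D0 by simp
      qed
    qed simp
    have "0 \<le> (LINT z|half_space_measure. U z * time_deriv f z + V z \<bullet> space_grad f z)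
          + (LINT x|lebesgue. \<bar>u0 x - b k\<bar> * f (0, x))"
      unfolding U_def V_def
      by (rule mv[unfolded mv_entropy_solution_def, THEN conjunct2, THEN spec, THEN bspec, THEN mp])
         (use f in \<open>simp_all add: admissible_test_def\<close>)
    also have "(LINT z|half_space_measure. U z * time_deriv f z + V z \<bullet> space_grad f z) =
        (LINT z|half_space_measure. U z * time_deriv f z) + (LINT z|half_space_measure. V z \<bullet> space_grad f z)"
      by (rule Bochner_Integration.integral_add[OF i1 i2])
    also have "(LINT z|half_space_measure. U z * time_deriv f z) =
        (LINT z|half_space_measure. \<bar>u z - b k\<bar> * time_deriv f z)"
      by (rule integral_cong_AE; (measurable; fail)?) (use U_eq in \<open>eventually_elim; simp\<close>)
    also have "(LINT z|half_space_measure. V z \<bullet> space_grad f z) \<le>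
        (LINT z|half_space_measure. D * norm (space_grad f z))"
    proof (rule integral_mono_AE[OF i2 integrable_mult_right[OF integrable_norm[OF s]]])
      show "AE z in half_space_measure. V z \<bullet> space_grad f z \<le> D * norm (space_grad f z)"
        using V_le
      proof eventually_elim
        case (elim z)
        have "V z \<bullet> space_grad f z \<le> norm (V z) * norm (space_grad f z)"
          by (rule norm_cauchy_schwarz)
        also have "\<dots> \<le> D * norm (space_grad f z)"
          using elim by (intro mult_right_mono) auto
        finally show ?case .
      qed
    qed
    finally show "0 \<le> (LINT z|half_space_measure. \<bar>u z - b k\<bar> * time_deriv f z)
       + D * (LINT z|half_space_measure. norm (space_grad f z))
       + (LINT x|lebesgue. \<bar>u0 x - b k\<bar> * f (0, x))"
      by simp
  qed
qed

lemma abs_diff_outside: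
  fixes x :: real
  assumes "\<bar>x\<bar> \<le> c"
  shows "y \<le> - c \<Longrightarrow> \<bar>x - y\<bar> = x - y" "c \<le> y \<Longrightarrow> \<bar>x - y\<bar> = y - x"
  using assms by arith+

text \<open>One half of the conservation law is taken from each solution: a low constant for
  \<open>u\<close>, a high one for \<open>w\<close>. The flux terms add up instead of cancelling,
  which costs only a multiple of the gradient integral. The identity assumed of \<open>f\<close> is
  integration by parts in t.\<close>

lemma entropy_solutions_difference_bound:
  fixes g :: "real \<Rightarrow> real ^ 'n"
  assumes sol: "entropy_solution b g u0 u" "entropy_solution b g u0 w"
    and u0: "u0 \<in> L_infty lebesgue"
    and b: "continuous_on UNIV b" "filterlim b at_top at_top" "filterlim b at_bot at_bot"
    and g: "continuous_on UNIV g"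
  obtains D where "D \<ge> 0" "\<And>f. admissible_test f \<Longrightarrow>
    (LINT z|half_space_measure. time_deriv f z) = - (LINT x|lebesgue. f (0, x)) \<Longrightarrow>
    (LINT z|half_space_measure. (u z - w z) * - time_deriv f z) \<le>
       D * (LINT z|half_space_measure. norm (space_grad f z))"
proof -
  from sol have "u \<in> L_infty half_space_measure" "w \<in> L_infty half_space_measure"
    by (auto simp: entropy_solution_def)
  then obtain C1 C2 where C1: "AE z in half_space_measure. \<bar>u z\<bar> \<le> C1"
    and C2: "AE z in half_space_measure. \<bar>w z\<bar> \<le> C2"
    and [measurable]: "u \<in> borel_measurable half_space_measure" "w \<in> borel_measurable half_space_measure"
    unfolding L_infty_def by auto
  from u0 obtain C3 where C3: "AE x in lebesgue. \<bar>u0 x\<bar> \<le> C3"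
    and [measurable]: "u0 \<in> borel_measurable lebesgue" unfolding L_infty_def by auto
  \<comment> \<open>A common bound for \<open>u\<close>, \<open>w\<close> and \<open>u0\<close>;
    coercivity of \<open>b\<close> provides parameters whose \<open>b\<close>-values lie on either
    side of [-C, C].\<close>
  define C where "C = max C1 (max C2 C3)"
  obtain k where "b k \<ge> C"
    using b(2) unfolding filterlim_at_top eventually_at_top_linorder by blast
  then have k: "C2 \<le> b k" "C3 \<le> b k" by (simp_all add: C_def)
  obtain l where "b l \<le> -C"
    using b(3) unfolding filterlim_at_bot eventually_at_bot_linorder by blast
  then have l: "b l \<le> - C1" "b l \<le> - C3" unfolding C_def by linarith+
  obtain D1 where D1: "D1 \<ge> 0" "\<And>f. admissible_test f \<Longrightarrow>
    0 \<le> (LINT z|half_space_measure. \<bar>u z - b l\<bar> * time_deriv f z)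
       + D1 * (LINT z|half_space_measure. norm (space_grad f z))
       + (LINT x|lebesgue. \<bar>u0 x - b l\<bar> * f (0, x))"
    using entropy_solution_inequality[OF sol(1) b(1) g, of l] by blast
  obtain D2 where D2: "D2 \<ge> 0" "\<And>f. admissible_test f \<Longrightarrow>
    0 \<le> (LINT z|half_space_measure. \<bar>w z - b k\<bar> * time_deriv f z)
       + D2 * (LINT z|half_space_measure. norm (space_grad f z))
       + (LINT x|lebesgue. \<bar>u0 x - b k\<bar> * f (0, x))"
    using entropy_solution_inequality[OF sol(2) b(1) g, of k] by blast
  show thesis
  proof (rule that[of "D1 + D2"])
    show "0 \<le> D1 + D2" using D1 D2 by simp
    fix f :: "real \<times> (real ^ 'n) \<Rightarrow> real" assume f: "admissible_test f"
      and eq: "(LINT z|half_space_measure. time_deriv f z) = - (LINT x|lebesgue. f (0, x))"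
    then have t: "integrable half_space_measure (time_deriv f)"
      and i: "integrable lebesgue (\<lambda>x. f (0, x))"
      by (auto simp: admissible_test_def)
    note [measurable] = borel_measurable_integrable[OF t] borel_measurable_integrable[OF i]
    have it: "integrable half_space_measure (\<lambda>z. v z * time_deriv f z)"
      if "v \<in> borel_measurable half_space_measure" "AE z in half_space_measure. \<bar>v z\<bar> \<le> c" for v c
    proof (rule Bochner_Integration.integrable_bound[OF integrable_mult_right[OF t, of c]])
      show "AE z in half_space_measure. norm (v z * time_deriv f z) \<le> norm (c * time_deriv f z)"
        using that(2) by eventually_elim (auto simp: abs_mult intro!: mult_right_mono)
    qed (use that(1) in simp)
    have i0: "integrable lebesgue (\<lambda>x. u0 x * f (0, x))"
    proof (rule Bochner_Integration.integrable_bound[OF integrable_mult_right[OF i, of C3]])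
      show "AE x in lebesgue. norm (u0 x * f (0, x)) \<le> norm (C3 * f (0, x))"
        using C3 by eventually_elim (auto simp: abs_mult intro!: mult_right_mono)
    qed simp
    have "(LINT z|half_space_measure. \<bar>u z - b l\<bar> * time_deriv f z) =
        (LINT z|half_space_measure. u z * time_deriv f z - b l * time_deriv f z)"
      by (rule integral_cong_AE; (measurable; fail)?)
         (use C1 in \<open>eventually_elim; use abs_diff_outside l in \<open>simp add: algebra_simps\<close>\<close>)
    also have "\<dots> = (LINT z|half_space_measure. u z * time_deriv f z) - b l * (LINT z|half_space_measure. time_deriv f z)"
      using it[OF _ C1] t by simp
    finally have e1: "(LINT z|half_space_measure. \<bar>u z - b l\<bar> * time_deriv f z) =
      (LINT z|half_space_measure. u z * time_deriv f z) - b l * (LINT z|half_space_measure. time_deriv f z)" .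
    have "(LINT z|half_space_measure. \<bar>w z - b k\<bar> * time_deriv f z) =
        (LINT z|half_space_measure. b k * time_deriv f z - w z * time_deriv f z)"
      by (rule integral_cong_AE; (measurable; fail)?)
         (use C2 in \<open>eventually_elim; use abs_diff_outside k in \<open>simp add: algebra_simps\<close>\<close>)
    also have "\<dots> = b k * (LINT z|half_space_measure. time_deriv f z) - (LINT z|half_space_measure. w z * time_deriv f z)"
      using it[OF _ C2] t by simp
    finally have e2: "(LINT z|half_space_measure. \<bar>w z - b k\<bar> * time_deriv f z) =
      b k * (LINT z|half_space_measure. time_deriv f z) - (LINT z|half_space_measure. w z * time_deriv f z)" .
    have "(LINT x|lebesgue. \<bar>u0 x - b l\<bar> * f (0, x)) = (LINT x|lebesgue. u0 x * f (0, x) - b l * f (0, x))"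
      by (rule integral_cong_AE; (measurable; fail)?)
         (use C3 in \<open>eventually_elim; use abs_diff_outside l in \<open>simp add: algebra_simps\<close>\<close>)
    also have "\<dots> = (LINT x|lebesgue. u0 x * f (0, x)) - b l * (LINT x|lebesgue. f (0, x))"
      using i0 i by simp
    finally have e3: "(LINT x|lebesgue. \<bar>u0 x - b l\<bar> * f (0, x)) =
      (LINT x|lebesgue. u0 x * f (0, x)) - b l * (LINT x|lebesgue. f (0, x))" .
    have "(LINT x|lebesgue. \<bar>u0 x - b k\<bar> * f (0, x)) = (LINT x|lebesgue. b k * f (0, x) - u0 x * f (0, x))"
      by (rule integral_cong_AE; (measurable; fail)?)
         (use C3 in \<open>eventually_elim; use abs_diff_outside k in \<open>simp add: algebra_simps\<close>\<close>)
    also have "\<dots> = b k * (LINT x|lebesgue. f (0, x)) - (LINT x|lebesgue. u0 x * f (0, x))"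
      using i0 i by simp
    finally have e4: "(LINT x|lebesgue. \<bar>u0 x - b k\<bar> * f (0, x)) =
      b k * (LINT x|lebesgue. f (0, x)) - (LINT x|lebesgue. u0 x * f (0, x))" .
    have "(LINT z|half_space_measure. (u z - w z) * - time_deriv f z) =
       (LINT z|half_space_measure. w z * time_deriv f z - u z * time_deriv f z)"
      by (simp add: algebra_simps)
    also have "\<dots> = (LINT z|half_space_measure. w z * time_deriv f z) - (LINT z|half_space_measure. u z * time_deriv f z)"
      using it[OF _ C1] it[OF _ C2] by simp
    \<comment> \<open>In the sum of the two inequalities the \<open>b l\<close> terms cancel by
      \<open>eq\<close>, likewise the \<open>b k\<close> terms, and the \<open>u0\<close> terms
      occur with opposite signs.\<close>
    finally show "(LINT z|half_space_measure. (u z - w z) * - time_deriv f z) \<le>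
       (D1 + D2) * (LINT z|half_space_measure. norm (space_grad f z))"
      using D1(2)[OF f] D2(2)[OF f] unfolding e1 e2 e3 e4 eq by (simp add: algebra_simps)
  qed
qed

subsection \<open>The cutoff function\<close>

text \<open>Squaring removes the kink of the positive part: the result is C^1 with derivative 2
  max(0, s), which suffices for a test function.\<close>

definition pos_sq :: "real \<Rightarrow> real" where
  "pos_sq s = (max 0 s)\<^sup>2"

lemma pos_sq_nonneg [simp]: "0 \<le> pos_sq s"
  and pos_sq_eq_0 [simp]: "s \<le> 0 \<Longrightarrow> pos_sq s = 0"
  and pos_sq_mono: "s \<le> s' \<Longrightarrow> pos_sq s \<le> pos_sq s'"
  by (auto simp: pos_sq_def max_def intro!: power_mono)

lemma pos_sq_has_derivative:
  "(pos_sq has_real_derivative 2 * max 0 s) (at s)"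
proof (cases s "0 :: real" rule: linorder_cases)
  case greater
  have "((\<lambda>s. s\<^sup>2) has_real_derivative 2 * max 0 s) (at s)"
    using greater by (auto intro!: derivative_eq_intros)
  then show ?thesis
    by (rule has_field_derivative_transform_within_open[of _ _ _ "{0<..}"])
       (use greater in \<open>auto simp: pos_sq_def\<close>)
next
  case less
  have "((\<lambda>s. 0) has_real_derivative 2 * max 0 s) (at s)"
    using less by (auto intro!: derivative_eq_intros)
  then show ?thesis
    by (rule has_field_derivative_transform_within_open[of _ _ _ "{..<0}"])
       (use less in \<open>auto simp: pos_sq_def\<close>)
next
  case equal
  \<comment> \<open>The difference quotient at 0 is h for positive h and 0 for negative h.\<close>
  have "((\<lambda>h. (pos_sq h - pos_sq 0) / h) \<longlongrightarrow> 0) (at 0)"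
  proof (rule Lim_null_comparison)
    show "\<forall>\<^sub>F h in at 0. norm ((pos_sq h - pos_sq 0) / h) \<le> norm h"
      by (rule always_eventually) (auto simp: pos_sq_def power2_eq_square max_def divide_simps)
    show "((\<lambda>h::real. norm h) \<longlongrightarrow> 0) (at 0)"
      by (rule tendsto_norm_zero) (rule tendsto_ident_at)
  qed
  then show ?thesis using equal by (simp add: DERIV_def)
qed

lemma continuous_on_pos_sq [continuous_intros]:
  "continuous_on S f \<Longrightarrow> continuous_on S (\<lambda>x. pos_sq (f x))"
  unfolding pos_sq_def by (intro continuous_intros)

text \<open>Using |x|^2 instead of |x| avoids a singularity at the origin. The time factor is
  positive at t = 0, so the initial data are seen by the test.\<close>

definition cutoff :: "real \<Rightarrow> real \<Rightarrow> real \<times> (real ^ 'n) \<Rightarrow> real" where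
  "cutoff T N z = pos_sq (T - fst z) * pos_sq (1 - (snd z \<bullet> snd z) / N\<^sup>2)"

text \<open>Like \<open>cutoff_space_grad\<close>, a closed formula on all of space-time, where
  continuity is immediate; \<open>cutoff_derivatives\<close> identifies both with the one-sided
  derivatives on the closed half-space.\<close>

definition cutoff_time_deriv :: "real \<Rightarrow> real \<Rightarrow> real \<times> (real ^ 'n) \<Rightarrow> real" where
  "cutoff_time_deriv T N z = - (2 * max 0 (T - fst z)) * pos_sq (1 - (snd z \<bullet> snd z) / N\<^sup>2)"

definition cutoff_space_grad :: "real \<Rightarrow> real \<Rightarrow> real \<times> (real ^ 'n) \<Rightarrow> real ^ 'n" where
  "cutoff_space_grad T N z =
     (pos_sq (T - fst z) * (2 * max 0 (1 - (snd z \<bullet> snd z) / N\<^sup>2)) * (- (2 / N\<^sup>2))) *\<^sub>R snd z"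

lemma continuous_on_cutoff:
  "continuous_on S (cutoff T N)" "continuous_on S (cutoff_time_deriv T N)"
  "continuous_on S (cutoff_space_grad T N)"
  unfolding cutoff_def[abs_def] cutoff_time_deriv_def[abs_def] cutoff_space_grad_def[abs_def]
    divide_inverse
  by (intro continuous_intros)+

lemma cutoff_has_derivative:
  fixes z :: "real \<times> (real ^ 'n)"
  shows "(cutoff T N has_derivative (\<lambda>h. fst h * cutoff_time_deriv T N z + cutoff_space_grad T N z \<bullet> snd h))
     (at z within S)"
proof -
  have p: "((\<lambda>z. pos_sq (f z)) has_derivative (\<lambda>h. f' h * (2 * max 0 (f z)))) (at z within S)"
    if "(f has_derivative f') (at z within S)" for f f' and z :: "real \<times> (real ^ 'n)"
    using has_derivative_compose[OF that pos_sq_has_derivative[of "f z", unfolded has_field_derivative_def]]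
    by (simp add: mult.commute)
  have "((\<lambda>z. pos_sq (1 - (snd z \<bullet> snd z) / N\<^sup>2)) has_derivative
      (\<lambda>h. (- (2 / N\<^sup>2) * (snd z \<bullet> snd h)) * (2 * max 0 (1 - (snd z \<bullet> snd z) / N\<^sup>2)))) (at z within S)"
    by (rule p) (auto intro!: derivative_eq_intros simp: inner_commute divide_inverse algebra_simps)
  moreover have "((\<lambda>z. pos_sq (T - fst z)) has_derivative (\<lambda>h. - fst h * (2 * max 0 (T - fst z)))) (at z within S)"
    by (rule p) (auto intro!: derivative_eq_intros)
  ultimately show ?thesis
    unfolding cutoff_def[abs_def]
    by (intro has_derivative_eq_rhs[OF has_derivative_mult])
       (auto simp: cutoff_time_deriv_def cutoff_space_grad_def fun_eq_iff algebra_simps)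
qed

text \<open>At t = 0 uniqueness needs admissible steps in every coordinate direction. Basis vectors
  have a nonnegative time component, so small positive steps never leave the half-space.\<close>

lemma frechet_derivative_within_closed_half_space:
  fixes f :: "real \<times> (real ^ 'n) \<Rightarrow> real"
  assumes D: "(f has_derivative D) (at z within closed_half_space)" and z: "z \<in> closed_half_space"
  shows "frechet_derivative f (at z within closed_half_space) = D"
proof (rule frechet_derivative_unique_within[OF _ D])
  show "(f has_derivative frechet_derivative f (at z within closed_half_space)) (at z within closed_half_space)"
    using D by (auto simp: frechet_derivative_works[symmetric] differentiable_def)
  fix i :: "real \<times> (real ^ 'n)" and e :: real assume i: "i \<in> Basis" and e: "0 < e"
  from i have "0 \<le> fst i" by (auto simp: Basis_prod_def)
  then have "z + (e / 2) *\<^sub>R i \<in> closed_half_space"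
    using z e by (cases z; cases i) (simp add: closed_half_space_def)
  then show "\<exists>d. 0 < \<bar>d\<bar> \<and> \<bar>d\<bar> < e \<and> z + d *\<^sub>R i \<in> closed_half_space"
    using e by (intro exI[of _ "e / 2"]) simp
qed

lemma cutoff_derivatives:
  fixes z :: "real \<times> (real ^ 'n)"
  assumes "z \<in> closed_half_space"
  shows "time_deriv (cutoff T N) z = cutoff_time_deriv T N z"
    and "space_grad (cutoff T N) z = cutoff_space_grad T N z"
  unfolding time_deriv_def space_grad_def
    frechet_derivative_within_closed_half_space[OF cutoff_has_derivative assms]
  by (simp_all add: inner_axis)

abbreviation cylinder :: "real \<Rightarrow> real \<Rightarrow> (real \<times> (real ^ 'n)) set" where
  "cylinder T N \<equiv> {0..T} \<times> cball 0 N"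

lemma compact_cylinder: "compact (cylinder T N)"
  by (intro compact_Times) auto

lemma cutoff_outside:
  assumes "z \<in> closed_half_space" "z \<notin> cylinder T N" "0 < N"
  shows "cutoff T N z = 0" "cutoff_time_deriv T N z = 0" "cutoff_space_grad T N z = 0"
proof -
  obtain t x where z: "z = (t, x)" by fastforce
  have "T - t \<le> 0 \<or> 1 - (x \<bullet> x) / N\<^sup>2 \<le> 0"
  proof (cases "t \<le> T")
    case True
    with assms have "N < norm x" by (auto simp: z)
    then have "N\<^sup>2 \<le> x \<bullet> x" using assms(3) by (simp add: power2_norm_eq_inner[symmetric] power_mono)
    then show ?thesis using assms(3) by simp
  qed simp
  then show "cutoff T N z = 0" "cutoff_time_deriv T N z = 0" "cutoff_space_grad T N z = 0"
    by (auto simp: z cutoff_def cutoff_time_deriv_def cutoff_space_grad_def max_def)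
qed

section \<open>Integrals of the cutoff and its derivatives\<close>

lemma cylinder_finite_measure:
  fixes N T :: real
  assumes "0 \<le> N" "0 \<le> T"
  shows "emeasure half_space_measure (cylinder T N \<inter> open_half_space :: (real \<times> (real ^ 'n)) set) < \<infinity>"
    and "measure half_space_measure (cylinder T N \<inter> open_half_space :: (real \<times> (real ^ 'n)) set)
      \<le> T * (unit_ball_vol CARD('n) * N ^ CARD('n))"
proof -
  let ?K = "cylinder T N :: (real \<times> (real ^ 'n)) set"
  have K: "?K \<in> sets lborel" using borel_compact[OF compact_cylinder] by simp
  have "emeasure lborel ?K = emeasure (lborel \<Otimes>\<^sub>M lborel) ?K" by (simp add: lborel_prod)
  also have "\<dots> = ennreal T * ennreal (unit_ball_vol CARD('n) * N ^ CARD('n))"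
    using assms by (subst lborel.emeasure_pair_measure_Times) (auto simp: emeasure_cball)
  also have "\<dots> = ennreal (T * (unit_ball_vol CARD('n) * N ^ CARD('n)))"
    using assms by (simp add: ennreal_mult)
  finally have eK: "emeasure lborel ?K = ennreal (T * (unit_ball_vol CARD('n) * N ^ CARD('n)))" .
  have "emeasure half_space_measure (?K \<inter> open_half_space) = emeasure lebesgue (?K \<inter> open_half_space)"
    by (rule emeasure_restrict_space) auto
  also have "\<dots> \<le> emeasure lebesgue ?K"
    using K by (intro emeasure_mono) auto
  also have "\<dots> = ennreal (T * (unit_ball_vol CARD('n) * N ^ CARD('n)))"
    using eK K by simp
  finally have le: "emeasure half_space_measure (?K \<inter> open_half_space)
      \<le> ennreal (T * (unit_ball_vol CARD('n) * N ^ CARD('n)))" .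
  then show "emeasure half_space_measure (?K \<inter> open_half_space) < \<infinity>"
    by (rule le_less_trans) (simp add: ennreal_less_top)
  show "measure half_space_measure (?K \<inter> open_half_space)
      \<le> T * (unit_ball_vol CARD('n) * N ^ CARD('n))"
    unfolding measure_def using enn2real_mono[OF le] assms by simp
qed

lemma cylinder_sets [simp, measurable]:
  "(cylinder T N \<inter> open_half_space :: (real \<times> (real ^ 'n)) set) \<in> sets half_space_measure"
proof -
  have "(cylinder T N :: (real \<times> (real ^ 'n)) set) \<in> sets lborel"
    using borel_compact[OF compact_cylinder] by simp
  then have "(cylinder T N :: (real \<times> (real ^ 'n)) set) \<in> sets lebesgue" by simp
  then show ?thesis by (simp add: sets_restrict_space_iff)
qed

text \<open>\<open>F\<close> is an explicit continuous formula and \<open>f\<close> a derivative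
  that agrees with it only on the closed half-space; measurability and boundedness are taken from
  \<open>F\<close>.\<close>

lemma integrable_half_space_compact_support:
  fixes F f :: "real \<times> (real ^ 'n) \<Rightarrow> 'b::euclidean_space"
  assumes F: "continuous_on UNIV F" and eq: "\<And>z. z \<in> closed_half_space \<Longrightarrow> f z = F z"
    and zero: "\<And>z. z \<in> closed_half_space \<Longrightarrow> z \<notin> cylinder T N \<Longrightarrow> F z = 0"
    and "0 \<le> N" "0 \<le> T"
  shows "integrable half_space_measure f"
proof -
  have "bounded (F ` cylinder T N)"
    by (intro compact_imp_bounded compact_continuous_image compact_cylinder continuous_on_subset[OF F]) auto
  then obtain B where B: "\<And>z. z \<in> cylinder T N \<Longrightarrow> norm (F z) \<le> B"
    unfolding bounded_iff by blast
  have eq': "f z = F z" if "z \<in> space half_space_measure" for z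
    using eq[of z] that by (simp add: open_half_space_imp_closed)
  have m: "F \<in> borel_measurable half_space_measure"
    by (intro measurable_restrict_space1 measurable_completion)
       (use borel_measurable_continuous_onI[OF F] in simp)
  have "integrable half_space_measure F"
  proof (rule integrableI_bounded_set[OF cylinder_sets m cylinder_finite_measure(1)])
    show "AE z in half_space_measure. z \<in> cylinder T N \<inter> open_half_space \<longrightarrow> norm (F z) \<le> B"
      using B by (intro AE_I2 impI) (elim IntE)
    show "AE z in half_space_measure. z \<notin> cylinder T N \<inter> open_half_space \<longrightarrow> F z = 0"
    proof (intro AE_I2 impI)
      fix z :: "real \<times> (real ^ 'n)"
      assume "z \<in> space half_space_measure" "z \<notin> cylinder T N \<inter> open_half_space"
      then show "F z = 0" using zero[of z] open_half_space_imp_closed[of z] by simp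
    qed
  qed (use assms(4,5) in auto)
  moreover have "integrable half_space_measure f \<longleftrightarrow> integrable half_space_measure F"
    by (rule Bochner_Integration.integrable_cong[OF refl]) (rule eq')
  ultimately show ?thesis by simp
qed

lemma cutoff_admissible:
  fixes T N :: real
  assumes "0 < T" "0 < N"
  shows "admissible_test (cutoff T N :: real \<times> (real ^ 'n) \<Rightarrow> real)"
  unfolding admissible_test_def
proof (intro conjI ballI)
  let ?f = "cutoff T N :: real \<times> (real ^ 'n) \<Rightarrow> real"
  show "?f \<in> test_functions"
    unfolding test_functions_def
  proof (intro CollectI conjI)
    show "?f differentiable_on closed_half_space"
      using cutoff_has_derivative unfolding differentiable_on_def differentiable_def by blast
    show "continuous_on closed_half_space (time_deriv ?f)"
      by (subst continuous_on_cong[OF refl cutoff_derivatives(1)]) (auto simp: continuous_on_cutoff)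
    show "continuous_on closed_half_space (space_grad ?f)"
      by (subst continuous_on_cong[OF refl cutoff_derivatives(2)]) (auto simp: continuous_on_cutoff)
    have "support_on closed_half_space ?f \<subseteq> cylinder T N"
      using cutoff_outside(1)[OF _ _ assms(2)] unfolding support_on_def by blast
    then show "compact (closure (support_on closed_half_space ?f))"
      using bounded_subset[OF compact_imp_bounded[OF compact_cylinder]] compact_closure by blast
  qed
  show "0 \<le> ?f z" for z by (simp add: cutoff_def)
  show "integrable half_space_measure (time_deriv ?f)"
    by (rule integrable_half_space_compact_support
          [OF continuous_on_cutoff(2) cutoff_derivatives(1) cutoff_outside(2)]) (use assms in auto)
  show "integrable half_space_measure (space_grad ?f)"
    by (rule integrable_half_space_compact_support
          [OF continuous_on_cutoff(3) cutoff_derivatives(2) cutoff_outside(3)]) (use assms in auto)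
  have c: "continuous_on UNIV (\<lambda>x. ?f (0, x))"
    by (rule continuous_on_compose2[OF continuous_on_cutoff(1)]) (auto intro!: continuous_intros)
  have "bounded ((\<lambda>x. ?f (0, x)) ` cball 0 N)"
    by (intro compact_imp_bounded compact_continuous_image continuous_on_subset[OF c]) auto
  then obtain B where B: "\<And>x. x \<in> cball 0 N \<Longrightarrow> norm (?f (0, x)) \<le> B"
    unfolding bounded_iff by blast
  have "integrable lborel (\<lambda>x. ?f (0, x))"
  proof (rule integrableI_bounded_set[of "cball 0 N"])
    show "(\<lambda>x. ?f (0, x)) \<in> borel_measurable lborel"
      using borel_measurable_continuous_onI[OF c] by simp
    show "AE x in lborel. x \<notin> cball 0 N \<longrightarrow> ?f (0, x) = 0"
      using assms by (intro AE_I2 impI cutoff_outside(1)) auto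
  qed (use B assms in \<open>auto simp: emeasure_cball\<close>)
  then show "integrable lebesgue (\<lambda>x. ?f (0, x))"
    using borel_measurable_continuous_onI[OF c] by (subst integrable_completion) auto
qed

lemma integral_neg_linear_cutoff:
  fixes T :: real
  assumes "0 < T"
  shows "(LINT t|lborel. indicator {0<..} t * - (2 * max 0 (T - t))) = - T\<^sup>2"
proof -
  have "(LINT t|lborel. indicator {0<..} t * - (2 * max 0 (T - t))) =
      (LINT t|lborel. - (2 * (T - t)) * indicator {0..T} t)"
  proof (rule integral_cong_AE)
    \<comment> \<open>The integrands differ only at t = 0, a null set; beyond T the truncation makes
      the left one vanish.\<close>
    show "AE t in lborel. indicator {0<..} t * - (2 * max 0 (T - t)) = - (2 * (T - t)) * indicator {0..T} t"
      using AE_lborel_singleton[of "0::real"]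
      by eventually_elim (auto simp: indicator_def max_def)
  qed auto
  also have "\<dots> = (T - T)\<^sup>2 - (T - 0)\<^sup>2"
    by (rule integral_FTC_Icc_real) (use assms in \<open>auto intro!: derivative_eq_intros\<close>)
  finally show ?thesis by simp
qed

text \<open>The time derivative is a product \<open>a t * h x\<close>, so by Fubini the claim
  reduces to the one-dimensional integral of \<open>a\<close>, which is -T^2.\<close>

lemma integral_cutoff_time_deriv:
  fixes T N :: real
  assumes "0 < T" "0 < N"
  shows "(LINT z|half_space_measure. time_deriv (cutoff T N :: real \<times> (real ^ 'n) \<Rightarrow> real) z) =
    - (LINT x|lebesgue. cutoff T N (0, x :: real ^ 'n))"
proof -
  let ?f = "cutoff T N :: real \<times> (real ^ 'n) \<Rightarrow> real"
  define h where "h x = pos_sq (1 - (x \<bullet> x) / N\<^sup>2)" for x :: "real ^ 'n"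
  define a where "a t = indicator {0<..} t * - (2 * max 0 (T - t))" for t :: real
  have h_m: "h \<in> borel_measurable borel"
    unfolding h_def divide_inverse by (intro borel_measurable_continuous_onI continuous_intros)
  have a_m: "a \<in> borel_measurable borel" unfolding a_def by measurable
  note [measurable] = h_m a_m
  have F: "indicator open_half_space z *\<^sub>R time_deriv ?f z = a (fst z) * h (snd z)" for z :: "real \<times> (real ^ 'n)"
  proof (cases "z \<in> open_half_space")
    case True
    then have "z \<in> closed_half_space" by (rule open_half_space_imp_closed)
    with True show ?thesis
      by (simp add: cutoff_derivatives) (cases z, simp add: a_def h_def cutoff_time_deriv_def)
  next
    case False then show ?thesis by (cases z) (simp add: a_def)
  qed
  \<comment> \<open>Fubini is applied to the Borel product measure. The integrand is Borel, so its
    integral is unchanged under completion.\<close>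
  have prod_m: "(\<lambda>z. a (fst z) * h (snd z)) \<in> borel_measurable (lborel :: (real \<times> (real ^ 'n)) measure)"
  proof -
    have "(\<lambda>z. a (fst z) * h (snd z)) \<in> borel_measurable (lborel \<Otimes>\<^sub>M lborel)"
      by measurable
    then show ?thesis by (simp only: lborel_prod)
  qed
  have "integrable half_space_measure (time_deriv ?f)"
    using cutoff_admissible[OF assms, where 'n = 'n] by (simp add: admissible_test_def)
  then have "integrable lebesgue (\<lambda>z :: real \<times> (real ^ 'n). a (fst z) * h (snd z))"
    using integrable_restrict_space[of open_half_space lebesgue "time_deriv ?f"] unfolding F by simp
  then have int: "integrable (lborel \<Otimes>\<^sub>M lborel) (\<lambda>z :: real \<times> (real ^ 'n). a (fst z) * h (snd z))"
    unfolding lborel_prod using integrable_completion[OF prod_m] by simp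
  have "(LINT z|half_space_measure. time_deriv ?f z) = (LINT z|lebesgue. a (fst z) * h (snd z))"
    using integral_restrict_space[of open_half_space lebesgue "time_deriv ?f"] unfolding F by simp
  also have "\<dots> = integral\<^sup>L (lborel \<Otimes>\<^sub>M lborel) (\<lambda>z. a (fst z) * h (snd z))"
    unfolding lborel_prod by (rule integral_completion[OF prod_m])
  also have "\<dots> = (LINT t|lborel. (LINT x|lborel. a t * h x))"
    using lborel_pair.integral_fst'[OF int] by simp
  also have "\<dots> = (LINT t|lborel. a t) * (LINT x|lborel. h x)"
    by simp
  also have "\<dots> = - (LINT x|lborel. T\<^sup>2 * h x)"
    using integral_neg_linear_cutoff[OF assms(1)] by (simp add: a_def)
  also have "(LINT x|lborel. T\<^sup>2 * h x) = (LINT x|lebesgue. T\<^sup>2 * h x)"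
    by (rule integral_completion[symmetric]) simp
  also have "(\<lambda>x. T\<^sup>2 * h x) = (\<lambda>x. ?f (0, x))"
    using assms by (simp add: fun_eq_iff cutoff_def h_def) (simp add: pos_sq_def)
  finally show ?thesis .
qed

text \<open>The gradient is at most T^2 * 4|x|/N^2, hence 4T^2/N on the cylinder; one factor 2 comes
  from \<open>pos_sq\<close>, the other from |x|^2. Multiplying by the volume of the cylinder gives
  order N^(n-1).\<close>

lemma integral_norm_cutoff_space_grad:
  fixes T N :: real
  assumes "0 < T" "0 < N"
  shows "(LINT z|half_space_measure. norm (space_grad (cutoff T N :: real \<times> (real ^ 'n) \<Rightarrow> real) z))
    \<le> 4 * T ^ 3 * unit_ball_vol CARD('n) * N ^ CARD('n) / N"
proof -
  let ?f = "cutoff T N :: real \<times> (real ^ 'n) \<Rightarrow> real"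
  let ?K = "cylinder T N \<inter> open_half_space :: (real \<times> (real ^ 'n)) set"
  have bound: "norm (space_grad ?f z) \<le> (4 * T\<^sup>2 / N) * indicator ?K z"
    if "z \<in> open_half_space" for z
  proof (cases "z \<in> cylinder T N")
    case True
    obtain t x where z: "z = (t, x)" by fastforce
    have zc: "z \<in> closed_half_space" using that by (rule open_half_space_imp_closed)
    have t: "0 \<le> t" and x: "norm x \<le> N" using True by (auto simp: z)
    have "pos_sq (T - t) \<le> pos_sq T" using t by (intro pos_sq_mono) simp
    also have "\<dots> = T\<^sup>2" using assms by (simp add: pos_sq_def)
    finally have 1: "pos_sq (T - t) \<le> T\<^sup>2" .
    have 2: "max 0 (1 - (x \<bullet> x) / N\<^sup>2) \<le> 1" by simp
    have "norm (cutoff_space_grad T N z) =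
        pos_sq (T - t) * max 0 (1 - (x \<bullet> x) / N\<^sup>2) * (4 / N\<^sup>2 * norm x)"
      using assms by (simp add: cutoff_space_grad_def z abs_mult abs_of_nonneg)
    also have "\<dots> \<le> T\<^sup>2 * 1 * (4 / N\<^sup>2 * N)"
      using x assms by (intro mult_mono 1 2) auto
    also have "\<dots> = 4 * T\<^sup>2 / N" using assms by (simp add: power2_eq_square)
    finally show ?thesis using True that by (simp add: cutoff_derivatives(2)[OF zc])
  next
    case False
    have zc: "z \<in> closed_half_space" using that by (rule open_half_space_imp_closed)
    show ?thesis using cutoff_outside(3)[OF zc False assms(2)] False
      by (simp add: cutoff_derivatives(2)[OF zc])
  qed
  have fin: "emeasure half_space_measure ?K < \<infinity>"
    using assms by (intro cylinder_finite_measure) auto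
  have "(LINT z|half_space_measure. norm (space_grad ?f z)) \<le>
      (LINT z|half_space_measure. (4 * T\<^sup>2 / N) * indicator ?K z)"
  proof (rule integral_mono)
    show "integrable half_space_measure (\<lambda>z. norm (space_grad ?f z))"
      using cutoff_admissible[OF assms, where 'n = 'n] by (simp add: admissible_test_def)
    show "integrable half_space_measure (\<lambda>z. (4 * T\<^sup>2 / N) * indicator ?K z)"
      using fin by (intro integrable_mult_right integrable_real_indicator) auto
  qed (use bound in simp)
  also have "\<dots> = (4 * T\<^sup>2 / N) * measure half_space_measure ?K"
    by (simp add: Int_assoc)
  also have "\<dots> \<le> (4 * T\<^sup>2 / N) * (T * (unit_ball_vol CARD('n) * N ^ CARD('n)))"
    using assms by (intro mult_left_mono cylinder_finite_measure) auto
  also have "\<dots> = 4 * T ^ 3 * unit_ball_vol CARD('n) * N ^ CARD('n) / N"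
    by (simp add: power2_eq_square power3_eq_cube)
  finally show ?thesis .
qed

text \<open>On the half-size cylinder 2(T - t) is at least T, and the spatial factor is at least (1
  - 1/4)^2 = 9/16.\<close>

lemma cutoff_time_deriv_bound:
  fixes z :: "real \<times> (real ^ 'n)"
  assumes "0 < T" "0 < N" "z \<in> open_half_space"
  shows "(9 / 16 * T) * indicator (cylinder (T / 2) (N / 2)) z \<le> - time_deriv (cutoff T N) z"
proof -
  obtain t x where z: "z = (t, x)" by fastforce
  have zc: "z \<in> closed_half_space" using assms(3) by (rule open_half_space_imp_closed)
  have e: "- time_deriv (cutoff T N) z = (2 * max 0 (T - t)) * pos_sq (1 - (x \<bullet> x) / N\<^sup>2)"
    using cutoff_derivatives(1)[OF zc] by (simp add: cutoff_time_deriv_def z)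
  show ?thesis
  proof (cases "z \<in> cylinder (T / 2) (N / 2)")
    case True
    then have "t \<le> T / 2" and x: "norm x \<le> N / 2" by (auto simp: z)
    then have 1: "T \<le> 2 * max 0 (T - t)" by (simp add: max_def)
    have "x \<bullet> x \<le> (N / 2)\<^sup>2"
      unfolding power2_norm_eq_inner[symmetric] using x by (intro power_mono) auto
    then have "(x \<bullet> x) / N\<^sup>2 \<le> 1 / 4"
      using assms(2) by (simp add: field_simps power2_eq_square)
    then have "pos_sq (3 / 4) \<le> pos_sq (1 - (x \<bullet> x) / N\<^sup>2)" by (intro pos_sq_mono) simp
    then have 2: "9 / 16 \<le> pos_sq (1 - (x \<bullet> x) / N\<^sup>2)" by (simp add: pos_sq_def power2_eq_square)
    have "T * (9 / 16) \<le> (2 * max 0 (T - t)) * pos_sq (1 - (x \<bullet> x) / N\<^sup>2)"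
      using assms by (intro mult_mono 1 2) auto
    then show ?thesis unfolding e using True by simp
  next
    case False then show ?thesis unfolding e by simp
  qed
qed

subsection \<open>Packing lattice translates\<close>

text \<open>Integer vectors stretched by a large \<open>q\<close> and mapped by the lattice matrix.
  Injectivity of the matrix bounds distances from below, its operator norm bounds lengths from
  above, and \<open>D\<close> does not depend on \<open>M\<close>.\<close>

lemma lattice_separated_points:
  fixes L :: "(real ^ 'n) set"
  assumes "is_lattice L"
  obtains p :: "('n \<Rightarrow> int) \<Rightarrow> real ^ 'n" and D :: real
  where "D > 0" "\<And>\<zeta>. p \<zeta> \<in> L" "\<And>\<zeta> \<zeta>'. \<zeta> \<noteq> \<zeta>' \<Longrightarrow> norm (p \<zeta> - p \<zeta>') > 2 * r"
    "\<And>\<zeta> M. (\<And>i. \<bar>\<zeta> i\<bar> \<le> int M) \<Longrightarrow> norm (p \<zeta>) \<le> D * M"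
proof -
  from assms obtain A :: "real ^ 'n ^ 'n" where A: "invertible A"
    and L: "L = (\<lambda>z. A *v z) ` {z. \<forall>i. z $ i \<in> \<int>}"
    unfolding is_lattice_def by blast
  have lin: "linear ((*v) A)" by (rule matrix_vector_mul_linear)
  obtain c where c: "c > 0" "\<And>x. c * norm x \<le> norm (A *v x)"
    using linear_inj_bounded_below_pos[OF lin inj_matrix_vector_mult[OF A]] by blast
  obtain K where K: "K > 0" "\<And>x. norm (A *v x) \<le> K * norm x"
    using linear_bounded_pos[OF lin] by blast
  \<comment> \<open>Distinct integer vectors are at distance at least 1, so their stretched images
    are at least c * q apart; \<open>q\<close> makes this exceed the diameter 2r of a ball.\<close>
  obtain q :: nat where "2 * \<bar>r\<bar> / c < real q" using reals_Archimedean2 by blast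
  then have qc: "2 * \<bar>r\<bar> < c * real q" using c(1) by (simp add: field_simps)
  then have q: "q > 0" using c(1) by (cases q) auto
  define v where "v \<zeta> = (\<chi> i. real q * real_of_int (\<zeta> i))" for \<zeta> :: "'n \<Rightarrow> int"
  define p where "p \<zeta> = A *v v \<zeta>" for \<zeta>
  show thesis
  proof (rule that)
    show "K * (CARD('n) * real q) > 0" using K q by simp
    show "p \<zeta> \<in> L" for \<zeta>
      unfolding L p_def by (intro imageI CollectI) (simp add: v_def)
    show "norm (p \<zeta> - p \<zeta>') > 2 * r" if "\<zeta> \<noteq> \<zeta>'" for \<zeta> \<zeta>'
    proof -
      from that obtain i where "\<zeta> i \<noteq> \<zeta>' i" by blast
      then have "1 \<le> \<bar>real_of_int (\<zeta> i - \<zeta>' i)\<bar>" by linarith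
      then have "real q * 1 \<le> real q * \<bar>real_of_int (\<zeta> i - \<zeta>' i)\<bar>"
        by (intro mult_left_mono) auto
      also have "\<dots> = \<bar>(v \<zeta> - v \<zeta>') $ i\<bar>"
        by (simp add: v_def abs_mult flip: right_diff_distrib)
      also have "\<dots> \<le> norm (v \<zeta> - v \<zeta>')" by (rule component_le_norm_cart)
      finally have "c * real q \<le> c * norm (v \<zeta> - v \<zeta>')" using c(1) by simp
      also have "\<dots> \<le> norm (A *v (v \<zeta> - v \<zeta>'))" by (rule c(2))
      also have "A *v (v \<zeta> - v \<zeta>') = p \<zeta> - p \<zeta>'"
        unfolding p_def by (rule linear_diff[OF lin])
      finally show ?thesis using qc by linarith
    qed
    show "norm (p \<zeta>) \<le> K * (CARD('n) * real q) * M" if "\<And>i. \<bar>\<zeta> i\<bar> \<le> int M" for \<zeta> M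
    proof -
      have "\<bar>v \<zeta> $ i\<bar> \<le> real q * M" for i
      proof -
        have "\<bar>real_of_int (\<zeta> i)\<bar> \<le> real M"
          using that[of i] by linarith
        then have "real q * \<bar>real_of_int (\<zeta> i)\<bar> \<le> real q * real M"
          by (intro mult_left_mono) auto
        then show ?thesis by (simp add: v_def abs_mult)
      qed
      then have "(\<Sum>i\<in>UNIV. \<bar>v \<zeta> $ i\<bar>) \<le> (\<Sum>i\<in>(UNIV :: 'n set). real q * M)"
        by (intro sum_mono)
      with norm_le_l1_cart[of "v \<zeta>"] have "norm (v \<zeta>) \<le> CARD('n) * (real q * M)" by simp
      then have "K * norm (v \<zeta>) \<le> K * (CARD('n) * (real q * M))"
        using K(1) by simp
      with K(2)[of "v \<zeta>"] show ?thesis by (simp add: p_def mult.assoc)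
    qed
  qed
qed

text \<open>The cylinder reaches t = 0 and is not a subset of the open half-space. Its intersection
  with the half-space is used instead; the two indicators agree on the space of the measure.\<close>

lemma L_infty_integrable_on_cylinder:
  fixes w :: "real \<times> (real ^ 'n) \<Rightarrow> real"
  assumes "w \<in> L_infty half_space_measure" "0 \<le> T" "0 \<le> R"
  shows "integrable half_space_measure (\<lambda>z. w z * indicator (cylinder T R) z)"
proof -
  obtain C where "AE z in half_space_measure. \<bar>w z\<bar> \<le> C"
    and "w \<in> borel_measurable half_space_measure"
    using assms(1) by (auto simp: L_infty_def)
  then have "integrable half_space_measure (\<lambda>z. indicator (cylinder T R \<inter> open_half_space) z *\<^sub>R w z)"
    using assms(2,3)
    by (intro integrableI_bounded_set_indicator[of _ _ _ C] cylinder_finite_measure cylinder_sets) auto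
  then show ?thesis
    by (rule Bochner_Integration.integrable_cong[THEN iffD1, OF refl, rotated])
       (simp add: indicator_def)
qed

text \<open>
  The number of disjoint translates of a fixed cylinder that fit into a cylinder of radius of
  order \<open>M\<close> grows like \<open>M ^ n\<close>, and by periodicity each of them carries the same mass.
\<close>

lemma periodic_mass_growth:
  fixes w :: "real \<times> (real ^ 'n) \<Rightarrow> real" and L :: "(real ^ 'n) set"
  assumes w: "w \<in> L_infty half_space_measure" "AE z in half_space_measure. 0 \<le> w z"
    and L: "is_lattice L" "\<And>e. e \<in> L \<Longrightarrow> AE z in half_space_measure. w (space_shift e z) = w z"
    and "0 \<le> T" "0 < r"
  obtains D :: real where "D > 0" "\<And>M :: nat. real M ^ CARD('n) * (LINT z|half_space_measure. w z * indicator (cylinder T r) z)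
      \<le> (LINT z|half_space_measure. w z * indicator (cylinder T (r + D * M)) z)"
proof -
  obtain p :: "('n \<Rightarrow> int) \<Rightarrow> real ^ 'n" and D :: real
  where D: "D > 0" and p: "\<And>\<zeta>. p \<zeta> \<in> L"
    and sep: "\<And>\<zeta> \<zeta>'. \<zeta> \<noteq> \<zeta>' \<Longrightarrow> norm (p \<zeta> - p \<zeta>') > 2 * r"
    and le: "\<And>\<zeta> M. (\<And>i. \<bar>\<zeta> i\<bar> \<le> int M) \<Longrightarrow> norm (p \<zeta>) \<le> D * M"
    using lattice_separated_points[OF L(1), of r] by metis
  note int = L_infty_integrable_on_cylinder[OF w(1) \<open>0 \<le> T\<close>]
  let ?m = "LINT z|half_space_measure. w z * indicator (cylinder T r) z"
  show thesis
  proof (rule that[OF D])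
    fix M :: nat
    define I where "I = PiE (UNIV :: 'n set) (\<lambda>_. {- int M..int M})"
    have I: "finite I" unfolding I_def by (intro finite_PiE) auto
    have card_I: "card I = (2 * M + 1) ^ CARD('n)"
    proof -
      have "card {- int M..int M} = 2 * M + 1" by simp
      then show ?thesis unfolding I_def by (simp only: card_PiE finite prod_constant)
    qed
    \<comment> \<open>Periodicity removes the shift from \<open>w\<close>, so translating the whole
      integrand has the same effect as translating only the indicator.\<close>
    have shifted: "integrable half_space_measure (\<lambda>z. w z * indicator (cylinder T r) (space_shift (- p \<zeta>) z)) \<and>
      (LINT z|half_space_measure. w z * indicator (cylinder T r) (space_shift (- p \<zeta>) z)) = ?m" for \<zeta>
    proof
      let ?h = "\<lambda>z. w z * indicator (cylinder T r) (space_shift (- p \<zeta>) z)"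
      have "AE z in half_space_measure. w (space_shift (- p \<zeta>) z) = w z"
        by (rule L(2)[OF lattice_uminus[OF L(1) p]])
      then have ae: "AE z in half_space_measure.
          w (space_shift (- p \<zeta>) z) * indicator (cylinder T r) (space_shift (- p \<zeta>) z) = ?h z"
        by eventually_elim simp
      have m1: "(\<lambda>z. w z * indicator (cylinder T r) z) \<in> borel_measurable half_space_measure"
        using int[of r] assms(6) by simp
      note m2 = measurable_compose[OF distr_space_shift(1)[of "- p \<zeta>"] m1]
      have m3: "?h \<in> borel_measurable half_space_measure"
      proof -
        have [measurable]: "w \<in> borel_measurable half_space_measure" using w(1) by (simp add: L_infty_def)
        have "indicat_real (cylinder T r \<inter> open_half_space :: (real \<times> (real ^ 'n)) set) \<in> borel_measurable half_space_measure"
          by simp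
        from measurable_compose[OF distr_space_shift(1)[of "- p \<zeta>"] this]
        have [measurable]: "(\<lambda>z. indicat_real (cylinder T r \<inter> open_half_space) (space_shift (- p \<zeta>) z))
          \<in> borel_measurable half_space_measure" .
        have "(\<lambda>z. w z * indicat_real (cylinder T r \<inter> open_half_space) (space_shift (- p \<zeta>) z))
          \<in> borel_measurable half_space_measure" by measurable
        then show ?thesis
          by (rule measurable_cong[THEN iffD1, rotated]) (simp add: indicator_def)
      qed
      have "integrable half_space_measure (\<lambda>z. w (space_shift (- p \<zeta>) z) *
          indicator (cylinder T r) (space_shift (- p \<zeta>) z))"
        using integrable_distr[OF distr_space_shift(1)[of "- p \<zeta>"], of "\<lambda>z. w z * indicator (cylinder T r) z"]
          int[of r] assms(6) by (simp add: distr_space_shift(2))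
      then show "integrable half_space_measure ?h"
        using integrable_cong_AE[OF m2 m3 ae] by simp
      have "(LINT z|half_space_measure. ?h z) = (LINT z|half_space_measure. w (space_shift (- p \<zeta>) z) *
          indicator (cylinder T r) (space_shift (- p \<zeta>) z))"
        by (rule integral_cong_AE[OF m2 m3 ae, symmetric])
      also have "\<dots> = ?m"
        by (rule integral_space_shift[of "\<lambda>z. w z * indicator (cylinder T r) z"])
      finally show "(LINT z|half_space_measure. ?h z) = ?m" .
    qed
    \<comment> \<open>A point in two translates would put their centres within 2r, against the
      separation; so at most one indicator is nonzero. The centres have norm at most D * M, whence
      the outer radius.\<close>
    have packing: "(\<Sum>\<zeta>\<in>I. indicat_real (cylinder T r) (space_shift (- p \<zeta>) z))
        \<le> indicator (cylinder T (r + D * M)) z" for z :: "real \<times> (real ^ 'n)"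
    proof -
      obtain t x where z: "z = (t, x)" by fastforce
      let ?J = "{\<zeta> \<in> I. space_shift (- p \<zeta>) z \<in> cylinder T r}"
      have "(\<Sum>\<zeta>\<in>I. indicat_real (cylinder T r) (space_shift (- p \<zeta>) z)) = card ?J"
        using I by (simp add: indicator_def of_bool_def[symmetric] sum.If_cases Int_def)
      also have "\<dots> \<le> indicator (cylinder T (r + D * M)) z"
      proof (cases "?J = {}")
        case False
        have "\<zeta> = \<zeta>'" if "\<zeta> \<in> ?J" "\<zeta>' \<in> ?J" for \<zeta> \<zeta>'
        proof (rule ccontr)
          assume "\<zeta> \<noteq> \<zeta>'"
          then have "2 * r < norm (p \<zeta> - p \<zeta>')" by (rule sep)
          also have "p \<zeta> - p \<zeta>' = (x - p \<zeta>') - (x - p \<zeta>)" by simp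
          also have "norm \<dots> \<le> norm (x - p \<zeta>') + norm (x - p \<zeta>)" by (rule norm_triangle_ineq4)
          also have "\<dots> \<le> 2 * r" using that by (simp add: z)
          finally show False by simp
        qed
        then have "card ?J \<le> 1" using I by (simp add: card_le_Suc0_iff_eq)
        moreover have "z \<in> cylinder T (r + D * M)"
        proof -
          from False obtain \<zeta> where "\<zeta> \<in> ?J" unfolding ex_in_conv[symmetric] by (elim exE)
          then have \<zeta>: "\<zeta> \<in> I" "space_shift (- p \<zeta>) z \<in> cylinder T r" by simp_all
          have "\<bar>\<zeta> i\<bar> \<le> int M" for i
            using PiE_mem[OF \<zeta>(1)[unfolded I_def], of i] by auto
          then have "norm (p \<zeta>) \<le> D * M" by (rule le)
          moreover have "norm x \<le> norm (x - p \<zeta>) + norm (p \<zeta>)"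
            using norm_triangle_ineq[of "x - p \<zeta>" "p \<zeta>"] by simp
          ultimately show ?thesis using \<zeta>(2) by (simp add: z)
        qed
        ultimately show ?thesis by simp
      next
        case True
        then show ?thesis by (simp only: True card.empty) simp
      qed
      finally show ?thesis .
    qed
    have "real M ^ CARD('n) * ?m \<le> card I * ?m"
    proof (rule mult_right_mono)
      \<comment> \<open>The exact count (2M+1)^n is weakened to M^n, since only the growth rate
        matters.\<close>
      show "real M ^ CARD('n) \<le> card I"
        unfolding card_I of_nat_power by (intro power_mono) auto
      have "AE z in half_space_measure. 0 \<le> w z * indicator (cylinder T r) z"
        using w(2) by eventually_elim simp
      then show "0 \<le> ?m" by (rule integral_nonneg_AE)
    qed
    also have "\<dots> = (\<Sum>\<zeta>\<in>I. LINT z|half_space_measure. w z * indicator (cylinder T r) (space_shift (- p \<zeta>) z))"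
      by (simp add: shifted)
    also have "\<dots> = (LINT z|half_space_measure. (\<Sum>\<zeta>\<in>I. w z * indicator (cylinder T r) (space_shift (- p \<zeta>) z)))"
      by (intro Bochner_Integration.integral_sum[symmetric]) (simp add: shifted)
    also have "\<dots> \<le> (LINT z|half_space_measure. w z * indicator (cylinder T (r + D * M)) z)"
    proof (rule integral_mono_AE)
      show "integrable half_space_measure (\<lambda>z. \<Sum>\<zeta>\<in>I. w z * indicator (cylinder T r) (space_shift (- p \<zeta>) z))"
        using shifted by (intro Bochner_Integration.integrable_sum) blast
      show "integrable half_space_measure (\<lambda>z. w z * indicator (cylinder T (r + D * M)) z)"
        using assms(6) D by (intro int) simp
      show "AE z in half_space_measure. (\<Sum>\<zeta>\<in>I. w z * indicator (cylinder T r) (space_shift (- p \<zeta>) z))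
          \<le> w z * indicator (cylinder T (r + D * M)) z"
        using w(2)
      proof eventually_elim
        case (elim z)
        show ?case
          unfolding sum_distrib_left[symmetric] by (rule mult_left_mono[OF packing elim])
      qed
    qed
    finally show "real M ^ CARD('n) * ?m
      \<le> (LINT z|half_space_measure. w z * indicator (cylinder T (r + D * M)) z)" .
  qed
qed

section \<open>Coincidence of ordered periodic solutions\<close>

text \<open>Extremality enters the theorem only by supplying periodicity and the order, so the
  comparison is made for any ordered pair of periodic solutions.\<close>

lemma periodic_entropy_solutions_le_imp_eq:
  fixes g :: "real \<Rightarrow> real ^ 'n" and L :: "(real ^ 'n) set"
  assumes sol: "entropy_solution b g u0 u" "entropy_solution b g u0 w"
    and u0: "u0 \<in> L_infty lebesgue"
    and b: "continuous_on UNIV b" "filterlim b at_top at_top" "filterlim b at_bot at_bot"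
    and g: "continuous_on UNIV g"
    and L: "is_lattice L" "\<And>e. e \<in> L \<Longrightarrow> AE z in half_space_measure. u (space_shift e z) = u z"
      "\<And>e. e \<in> L \<Longrightarrow> AE z in half_space_measure. w (space_shift e z) = w z"
    and le: "AE z in half_space_measure. w z \<le> u z"
  shows "AE z in half_space_measure. u z = w z"
proof -
  define d where "d z = u z - w z" for z
  have d_nonneg: "AE z in half_space_measure. 0 \<le> d z"
    using le by eventually_elim (simp add: d_def)
  have d_per: "AE z in half_space_measure. d (space_shift e z) = d z" if "e \<in> L" for e
    using L(2,3)[OF that] by eventually_elim (simp add: d_def)
  have d_Linf: "d \<in> L_infty half_space_measure"
  proof -
    obtain C1 C2 where "AE z in half_space_measure. \<bar>u z\<bar> \<le> C1" "AE z in half_space_measure. \<bar>w z\<bar> \<le> C2"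
      and [measurable]: "u \<in> borel_measurable half_space_measure" "w \<in> borel_measurable half_space_measure"
      using sol unfolding entropy_solution_def L_infty_def by auto
    from this(1,2) have "AE z in half_space_measure. \<bar>d z\<bar> \<le> C1 + C2"
      unfolding d_def by eventually_elim linarith
    moreover have "d \<in> borel_measurable half_space_measure" unfolding d_def by measurable
    ultimately show ?thesis unfolding L_infty_def by blast
  qed
  obtain C where d_le: "AE z in half_space_measure. \<bar>d z\<bar> \<le> C"
    and d_m [measurable]: "d \<in> borel_measurable half_space_measure"
    using d_Linf by (auto simp: L_infty_def)
  obtain D0 where D0: "D0 \<ge> 0" "\<And>f. admissible_test f \<Longrightarrow>
    (LINT z|half_space_measure. time_deriv f z) = - (LINT x|lebesgue. f (0, x)) \<Longrightarrow>
    (LINT z|half_space_measure. (u z - w z) * - time_deriv f z) \<le>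
       D0 * (LINT z|half_space_measure. norm (space_grad f z))"
    using entropy_solutions_difference_bound[OF sol u0 b g] by blast
  note int = L_infty_integrable_on_cylinder[OF d_Linf]
  \<comment> \<open>The upper half of the comparison. As \<open>d\<close> is nonnegative, the lower
    bound on -f_t over the half-size cylinder may be integrated against it.\<close>
  have mass_le: "(9 / 16 * T) * (LINT z|half_space_measure. d z * indicator (cylinder (T / 2) (N / 2)) z)
      \<le> D0 * (4 * T ^ 3 * unit_ball_vol CARD('n) * N ^ CARD('n) / N)" if TN: "0 < T" "0 < N" for T N
  proof -
    let ?f = "cutoff T N :: real \<times> (real ^ 'n) \<Rightarrow> real"
    have adm: "admissible_test ?f" by (rule cutoff_admissible[OF TN])
    then have t: "integrable half_space_measure (time_deriv ?f)" by (simp add: admissible_test_def)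
    note [measurable] = borel_measurable_integrable[OF t]
    have "(9 / 16 * T) * (LINT z|half_space_measure. d z * indicator (cylinder (T / 2) (N / 2)) z) =
      (LINT z|half_space_measure. d z * ((9 / 16 * T) * indicator (cylinder (T / 2) (N / 2)) z))"
      by (subst integral_mult_right_zero[symmetric]) (simp add: algebra_simps)
    also have "\<dots> \<le> (LINT z|half_space_measure. d z * - time_deriv ?f z)"
    proof (rule integral_mono_AE)
      have "integrable half_space_measure
          (\<lambda>z. (9 / 16 * T) * (d z * indicator (cylinder (T / 2) (N / 2)) z))"
        using TN by (intro integrable_mult_right int) auto
      then show "integrable half_space_measure
          (\<lambda>z. d z * ((9 / 16 * T) * indicator (cylinder (T / 2) (N / 2)) z))"
        by (simp add: algebra_simps)
      show "integrable half_space_measure (\<lambda>z. d z * - time_deriv ?f z)"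
      proof (rule Bochner_Integration.integrable_bound[OF integrable_mult_right[OF t, of C]])
        show "AE z in half_space_measure. norm (d z * - time_deriv ?f z) \<le> norm (C * time_deriv ?f z)"
          using d_le by eventually_elim (auto simp: abs_mult intro!: mult_right_mono)
      qed simp
      show "AE z in half_space_measure.
          d z * ((9 / 16 * T) * indicator (cylinder (T / 2) (N / 2)) z) \<le> d z * - time_deriv ?f z"
        using d_nonneg AE_space
      proof eventually_elim
        case (elim z)
        then show ?case using cutoff_time_deriv_bound[OF TN, of z] by (intro mult_left_mono) auto
      qed
    qed
    also have "\<dots> \<le> D0 * (LINT z|half_space_measure. norm (space_grad ?f z))"
      unfolding d_def by (rule D0(2)[OF adm integral_cutoff_time_deriv[OF TN]])
    also have "\<dots> \<le> D0 * (4 * T ^ 3 * unit_ball_vol CARD('n) * N ^ CARD('n) / N)"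
      by (intro mult_left_mono integral_norm_cutoff_space_grad TN D0(1))
    finally show ?thesis .
  qed
  have mass_zero: "(LINT z|half_space_measure. d z * indicator (cylinder (T / 2) r) z) = 0"
    if Tr: "0 < T" "0 < r" for T r
  proof -
    let ?m = "LINT z|half_space_measure. d z * indicator (cylinder (T / 2) r) z"
    obtain D :: real where D: "D > 0" "\<And>M :: nat. real M ^ CARD('n) * ?m
        \<le> (LINT z|half_space_measure. d z * indicator (cylinder (T / 2) (r + D * M)) z)"
      using periodic_mass_growth[OF d_Linf d_nonneg L(1) d_per, of "T / 2" r] Tr by auto
    have "AE z in half_space_measure. 0 \<le> d z * indicator (cylinder (T / 2) r) z"
      using d_nonneg by eventually_elim simp
    then have m0: "0 \<le> ?m" by (rule integral_nonneg_AE)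
    \<comment> \<open>One power of N is split off to cancel the division by N in
      \<open>mass_le\<close>.\<close>
    define n where "n = CARD('n) - 1"
    have n: "CARD('n) = Suc n" unfolding n_def by (simp add: card_gt_0_iff)
    define B where "B = D0 * (4 * T ^ 3 * unit_ball_vol CARD('n)) * (2 * (r + D)) ^ n"
    have "real M * ((9 / 16 * T) * ?m) \<le> B" if "M > 0" for M :: nat
    proof -
      \<comment> \<open>Chosen so that the half-size cylinder of the cutoff is exactly the one that
        contains the packed translates.\<close>
      define N where "N = 2 * (r + D * M)"
      have half_N: "N / 2 = r + D * M" by (simp add: N_def)
      have N: "0 < N" unfolding N_def using Tr D(1) that by (simp add: add_pos_nonneg)
      \<comment> \<open>Since M is at least 1, N is at most a fixed multiple of M; dividing by M^n
        then leaves a bound \<open>B\<close> independent of M.\<close>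
      have "r * 1 \<le> r * real M" using Tr that by (intro mult_left_mono) auto
      then have N_le: "N \<le> 2 * (r + D) * M" unfolding N_def by (simp add: algebra_simps)
      have "real M ^ n * (real M * ((9 / 16 * T) * ?m)) = (9 / 16 * T) * (real M ^ CARD('n) * ?m)"
        by (simp add: n)
      also have "\<dots> \<le> (9 / 16 * T) * (LINT z|half_space_measure. d z * indicator (cylinder (T / 2) (N / 2)) z)"
        unfolding half_N using D(2)[of M] Tr by (intro mult_left_mono) auto
      also have "\<dots> \<le> D0 * (4 * T ^ 3 * unit_ball_vol CARD('n) * N ^ CARD('n) / N)"
        by (rule mass_le[OF Tr(1) N])
      also have "\<dots> = D0 * (4 * T ^ 3 * unit_ball_vol CARD('n)) * N ^ n"
        using N by (simp add: n)
      also have "\<dots> \<le> D0 * (4 * T ^ 3 * unit_ball_vol CARD('n)) * (2 * (r + D) * M) ^ n"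
        using N N_le D0(1) Tr by (intro mult_left_mono power_mono) auto
      also have "\<dots> = real M ^ n * B"
        unfolding B_def power_mult_distrib by simp
      finally show ?thesis using that by simp
    qed
    \<comment> \<open>The maximum with 0 absorbs the case M = 0. A positive mass would make the
      left-hand side unbounded in M.\<close>
    then have bound: "real M * ((9 / 16 * T) * ?m) \<le> max B 0" for M :: nat
      by (cases "M = 0") (auto simp: le_max_iff_disj)
    have "(9 / 16 * T) * ?m \<le> 0"
    proof (rule ccontr)
      assume "\<not> (9 / 16 * T) * ?m \<le> 0"
      then obtain M :: nat where "max B 0 < real M * ((9 / 16 * T) * ?m)"
        using reals_Archimedean3[of "(9 / 16 * T) * ?m"] by auto
      with bound[of M] show False by simp
    qed
    then show ?thesis using m0 Tr by (simp add: mult_le_0_iff)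
  qed
  \<comment> \<open>Countably many cylinders exhaust the half-space; the height
    \<open>Suc k / 2\<close> matches the form of \<open>mass_zero\<close>. On each of them a
    nonnegative function has integral zero.\<close>
  have "AE z in half_space_measure. \<forall>k::nat. d z * indicator (cylinder (Suc k / 2) (Suc k)) z = 0"
  proof (rule AE_all_countable[THEN iffD2], intro allI)
    fix k :: nat
    let ?h = "\<lambda>z. d z * indicator (cylinder (Suc k / 2) (Suc k)) z"
    have "AE z in half_space_measure. 0 \<le> ?h z"
      using d_nonneg by eventually_elim simp
    moreover have "(LINT z|half_space_measure. ?h z) = 0"
      by (rule mass_zero) simp_all
    moreover have "integrable half_space_measure ?h"
      by (rule int) simp_all
    ultimately show "AE z in half_space_measure. ?h z = 0"
      using integral_nonneg_eq_0_iff_AE by blast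
  qed
  then show ?thesis
    using AE_space
  proof eventually_elim
    case (elim z)
    obtain t x where z: "z = (t, x)" by fastforce
    obtain k :: nat where k: "2 * t + norm x < real k" using reals_Archimedean2 by blast
    have "0 < t" using elim(2) by (simp add: z)
    with k have "2 * t \<le> 1 + real k" "norm x \<le> 1 + real k"
      using norm_ge_zero[of x] by linarith+
    with \<open>0 < t\<close> have "z \<in> cylinder (Suc k / 2) (Suc k)" by (simp add: z)
    with elim(1)[rule_format, of k] show ?case by (simp add: d_def)
  qed
qed

theorem theorem5p1:
  fixes \<phi> :: "real \<Rightarrow> real ^ 'n"
    and b :: "real \<Rightarrow> real"
    and g :: "real \<Rightarrow> real ^ 'n"
    and L :: "(real ^ 'n) set"
    and u0 :: "real ^ 'n \<Rightarrow> real"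
    and u_plus u_minus :: "real \<times> (real ^ 'n) \<Rightarrow> real"
  assumes "jump_continuous \<phi>"
    and "graph_parametrization \<phi> b g"
    and "is_lattice L"
    and "u0 \<in> L_infty lebesgue"
    and "\<forall>e\<in>L. AE x in lebesgue. u0 (x + e) = u0 x"
    and "largest_entropy_solution b g u0 u_plus"
    and "smallest_entropy_solution b g u0 u_minus"
  shows "(\<forall>e\<in>L. AE (t, x) in lebesgue_on open_half_space. u_plus (t, x + e) = u_plus (t, x)) \<and>
         (\<forall>e\<in>L. AE (t, x) in lebesgue_on open_half_space. u_minus (t, x + e) = u_minus (t, x)) \<and>
         (AE z in lebesgue_on open_half_space. u_plus z = u_minus z)"
proof -
  have per_plus: "AE z in half_space_measure. u_plus (space_shift e z) = u_plus z" if "e \<in> L" for e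
    by (rule largest_entropy_solution_periodic[OF assms(6,3,4,5) that])
  have per_minus: "AE z in half_space_measure. u_minus (space_shift e z) = u_minus z" if "e \<in> L" for e
    by (rule smallest_entropy_solution_periodic[OF assms(7,3,4,5) that])
  have par: "continuous_on UNIV b" "filterlim b at_top at_top" "filterlim b at_bot at_bot"
    "continuous_on UNIV g"
    using assms(2) by (simp_all add: graph_parametrization_def)
  have sol: "entropy_solution b g u0 u_plus" "entropy_solution b g u0 u_minus"
    using assms(6,7) by (simp_all add: largest_entropy_solution_def smallest_entropy_solution_def)
  \<comment> \<open>\<open>u_minus\<close> is itself one of the solutions dominated by
    \<open>u_plus\<close>.\<close>
  then have "AE z in half_space_measure. u_minus z \<le> u_plus z"
    using assms(6) by (simp add: largest_entropy_solution_def)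
  then have "AE z in half_space_measure. u_plus z = u_minus z"
    using periodic_entropy_solutions_le_imp_eq[OF sol assms(4) par assms(3) per_plus per_minus] by blast
  moreover have "AE (t, x) in half_space_measure. u (t, x + e) = u (t, x)"
    if "AE z in half_space_measure. u (space_shift e z) = u z" for u :: "real \<times> (real ^ 'n) \<Rightarrow> real" and e
    using that by eventually_elim (simp add: split_beta flip: space_shift_Pair)
  ultimately show ?thesis using per_plus per_minus by blast
qed

end
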